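(* Let $p\colon\mathbb{R}\to\mathbb{R}$ be bounded and uniformly continuous, assume that $x'=-x^2+p(t)$ has exactly two hyperbolic solutions, and take $c>0$. Suppose that the equation $$y'=-\Big(y-\frac{2}{\pi}\arctan(ct)\Big)^2+p(t)\qquad(E_c)$$ has exactly one bounded solution $\mathfrak{b}_c$ (Case B). Then, with $\mathfrak{a}_c,\mathfrak{r}_c,\tilde{\mathfrak{a}}^\pm,\tilde{\mathfrak{r}}^\pm$ as in the context: (B1) $\mathfrak{r}_c$ and $\mathfrak{a}_c$ coincide with $\mathfrak{b}_c$. (B2) The solution $\mathfrak{b}_c$ is locally pullback attractive and locally pullback repulsive. (B3) $\lim_{t\to-\infty}|\tilde{\mathfrak{a}}^-(t)-\mathfrak{b}_c(t)|=0$ and $\lim_{t\to\infty}|\tilde{\mathfrak{r}}^+(t)-\mathfrak{b}_c(t)|=0$. (B4) The following three conditions are equivalent: $y_0>\mathfrak{b}_c(s)$; $y_c(t,s,y_0)$ is unbounded as $t$ decreases; and $\lim_{t\to\infty}|\tilde{\mathfrak{a}}^+(t)-y_c(t,s,y_0)|=0$. (B5) The following three conditions are equivalent: $y_0<\mathfrak{b}_c(s)$; $y_c(t,s,y_0)$ is unbounded as $t$ increases; and $\lim_{t\to-\infty}|\tilde{\mathfrak{r}}^-(t)-y_c(t,s,y_0)|=0$.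
   Context: "Bounded solution" means defined and bounded on $\mathbb{R}$. $t\mapsto y_c(t,s,y_0)$ is the maximal solution of $(E_c)$ with $y_c(s,s,y_0)=y_0$. "Unbounded as $t$ decreases (increases)" means unbounded on the part of its maximal interval to the left (right) of $s$. A globally defined solution $\tilde b$ of a scalar equation $x'=h(t,x)$ is hyperbolic if there are $k\ge1$, $\beta>0$ such that either $\exp\int_s^t\frac{\partial h}{\partial x}(l,\tilde b(l))\,dl\le k\,e^{-\beta(t-s)}$ whenever $t\ge s$ (attractive), or $\exp\int_s^t\frac{\partial h}{\partial x}(l,\tilde b(l))\,dl\le k\,e^{\beta(t-s)}$ whenever $t\le s$ (repulsive). The two hyperbolic solutions of $x'=-x^2+p(t)$ are denoted $\tilde a$ (attractive) and $\tilde r$ (repulsive); then $\inf_{t\in\mathbb R}(\tilde a(t)-\tilde r(t))>0$. Put $\tilde{\mathfrak{a}}^\pm:=\tilde a\pm1$ and $\tilde{\mathfrak{r}}^\pm:=\tilde r\pm1$; these are the hyperbolic solutions of the limit equations $y'=-(y\mp1)^2+p(t)$. $\mathcal{R}_c^-$ is the set of $s\in\mathbb{R}$ for which there is $y_0$ such that $y_c(\cdot,s,y_0)$ is bounded above on the part of its maximal interval to the left of $s$, and $\mathfrak{a}_c(s)$ is the maximum of these $y_0$. $\mathcal{R}_c^+$ is the set of $s$ for which there is $y_0$ such that $y_c(\cdot,s,y_0)$ is bounded below on the part of its maximal interval to the right of $s$, and $\mathfrak{r}_c(s)$ is the minimum of these $y_0$. Under the assumption on $p$, $\mathfrak{a}_c\colon\mathcal{R}_c^-\to\mathbb{R}$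 and $\mathfrak{r}_c\colon\mathcal{R}_c^+\to\mathbb{R}$ exist for every $c>0$ and are solutions of $(E_c)$; if $(E_c)$ has a bounded solution, then $\mathcal{R}_c^-=\mathcal{R}_c^+=\mathbb{R}$. A solution $\bar a\colon(-\infty,\beta)\to\mathbb{R}$ ($\beta\le\infty$) of $y'=h(t,y)$, with maximal solutions $y(t,s,y_0)$, is locally pullback attractive if there exist $s_0<\beta$ and $\delta>0$ such that if $s\le s_0$ and $|y_0-\bar a(s)|<\delta$ then $y(t,s,y_0)$ is defined for $t\in[s,s_0]$, and in addition $\lim_{s\to-\infty}\max_{y_0\in[\bar a(s)-\delta,\bar a(s)+\delta]}|\bar a(t)-y(t,s,y_0)|=0$ for all $t\le s_0$; equivalently (scalar case), if $s\le s_0$ then $y(t,s,\bar a(s)\pm\delta)$ are defined for $t\in[s,s_0]$ and $\lim_{s\to-\infty}|\bar a(t)-y(t,s,\bar a(s)\pm\delta)|=0$ for all $t\le s_0$. A solution $\bar r\colon(\alpha,\infty)\to\mathbb{R}$ ($\alpha\ge-\infty$) is locally pullback repulsive if $t\mapsto\bar r(-t)$ is a locally pullback attractive solution of the time-reversed equation $y'=-h(-t,y)$; equivalently, there exist $s_0>\alpha$ and $\delta>0$ such that if $s\ge s_0$ then $y(t,s,\bar r(s)\pm\delta)$ are defined for $t\in[s_0,s]$ and $\lim_{s\to\infty}|\bar r(t)-y(t,s,\bar r(s)\pm\delta)|=0$ for all $t\ge s_0$. *)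

theory Defs
  imports "HOL-Analysis.Analysis"
begin

text \<open>Scalar equations \<open>x' = h t x\<close>. In all uses the domain \<open>J\<close> is an open interval.\<close>

definition ode_solution :: "(real \<Rightarrow> real \<Rightarrow> real) \<Rightarrow> real set \<Rightarrow> (real \<Rightarrow> real) \<Rightarrow> bool" where
  "ode_solution h J x \<longleftrightarrow> (\<forall>t\<in>J. (x has_real_derivative h t (x t)) (at t))"

definition bounded_solution :: "(real \<Rightarrow> real \<Rightarrow> real) \<Rightarrow> (real \<Rightarrow> real) \<Rightarrow> bool" where
  "bounded_solution h x \<longleftrightarrow> ode_solution h UNIV x \<and> bounded (range x)"

definition ivp_solution ::
    "(real \<Rightarrow> real \<Rightarrow> real) \<Rightarrow> real \<Rightarrow> real \<Rightarrow> real set \<Rightarrow> (real \<Rightarrow> real) \<Rightarrow> bool" where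
  "ivp_solution h s y0 J x \<longleftrightarrow>
     open J \<and> is_interval J \<and> s \<in> J \<and> ode_solution h J x \<and> x s = y0"

text \<open>The maximal solution \<open>t \<mapsto> y(t,s,y0)\<close> and its maximal interval. Solutions of the equations
  considered are locally unique, so the maximal solution is the union of all solutions of the
  initial value problem. Outside \<open>max_interval h s y0\<close> the value \<open>max_sol h t s y0\<close>
  carries no information.\<close>

definition max_interval :: "(real \<Rightarrow> real \<Rightarrow> real) \<Rightarrow> real \<Rightarrow> real \<Rightarrow> real set" where
  "max_interval h s y0 = \<Union>{J. \<exists>x. ivp_solution h s y0 J x}"

definition max_sol :: "(real \<Rightarrow> real \<Rightarrow> real) \<Rightarrow> real \<Rightarrow> real \<Rightarrow> real \<Rightarrow> real" where
  "max_sol h t s y0 = (THE v. \<exists>J x. ivp_solution h s y0 J x \<and> t \<in> J \<and> x t = v)"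

definition left_values :: "(real \<Rightarrow> real \<Rightarrow> real) \<Rightarrow> real \<Rightarrow> real \<Rightarrow> real set" where
  "left_values h s y0 = (\<lambda>t. max_sol h t s y0) ` (max_interval h s y0 \<inter> {..s})"

definition right_values :: "(real \<Rightarrow> real \<Rightarrow> real) \<Rightarrow> real \<Rightarrow> real \<Rightarrow> real set" where
  "right_values h s y0 = (\<lambda>t. max_sol h t s y0) ` (max_interval h s y0 \<inter> {s..})"

text \<open>Hyperbolicity. The interval integral \<open>LBINT l=s..t\<close> is oriented: it changes sign when
  \<open>t < s\<close>.\<close>

definition attractive_hyperbolic :: "(real \<Rightarrow> real \<Rightarrow> real) \<Rightarrow> (real \<Rightarrow> real) \<Rightarrow> bool" where
  "attractive_hyperbolic h b \<longleftrightarrow> ode_solution h UNIV b \<and>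
     (\<exists>k \<beta>. k \<ge> 1 \<and> \<beta> > 0 \<and>
       (\<forall>s t. t \<ge> s \<longrightarrow>
          exp (LBINT l=ereal s..ereal t. deriv (h l) (b l)) \<le> k * exp (- \<beta> * (t - s))))"

definition repulsive_hyperbolic :: "(real \<Rightarrow> real \<Rightarrow> real) \<Rightarrow> (real \<Rightarrow> real) \<Rightarrow> bool" where
  "repulsive_hyperbolic h b \<longleftrightarrow> ode_solution h UNIV b \<and>
     (\<exists>k \<beta>. k \<ge> 1 \<and> \<beta> > 0 \<and>
       (\<forall>s t. t \<le> s \<longrightarrow>
          exp (LBINT l=ereal s..ereal t. deriv (h l) (b l)) \<le> k * exp (\<beta> * (t - s))))"

definition hyperbolic_solution :: "(real \<Rightarrow> real \<Rightarrow> real) \<Rightarrow> (real \<Rightarrow> real) \<Rightarrow> bool" where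
  "hyperbolic_solution h b \<longleftrightarrow> attractive_hyperbolic h b \<or> repulsive_hyperbolic h b"

definition base_eq :: "(real \<Rightarrow> real) \<Rightarrow> real \<Rightarrow> real \<Rightarrow> real" where
  "base_eq p t x = - (x\<^sup>2) + p t"

definition E_eq :: "(real \<Rightarrow> real) \<Rightarrow> real \<Rightarrow> real \<Rightarrow> real \<Rightarrow> real" where
  "E_eq p c t y = - ((y - 2 / pi * arctan (c * t))\<^sup>2) + p t"

text \<open>When \<open>x' = -x\<^sup>2 + p t\<close> has exactly two hyperbolic solutions, exactly one of them is
  attractive and exactly one is repulsive, so the following descriptions are proper.\<close>

definition a_tilde :: "(real \<Rightarrow> real) \<Rightarrow> real \<Rightarrow> real" where
  "a_tilde p = (THE x. attractive_hyperbolic (base_eq p) x)"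

definition r_tilde :: "(real \<Rightarrow> real) \<Rightarrow> real \<Rightarrow> real" where
  "r_tilde p = (THE x. repulsive_hyperbolic (base_eq p) x)"

definition R_minus :: "(real \<Rightarrow> real) \<Rightarrow> real \<Rightarrow> real set" where
  "R_minus p c = {s. \<exists>y0. bdd_above (left_values (E_eq p c) s y0)}"

definition a_frak :: "(real \<Rightarrow> real) \<Rightarrow> real \<Rightarrow> real \<Rightarrow> real" where
  "a_frak p c s = (GREATEST y0. bdd_above (left_values (E_eq p c) s y0))"

definition R_plus :: "(real \<Rightarrow> real) \<Rightarrow> real \<Rightarrow> real set" where
  "R_plus p c = {s. \<exists>y0. bdd_below (right_values (E_eq p c) s y0)}"

definition r_frak :: "(real \<Rightarrow> real) \<Rightarrow> real \<Rightarrow> real \<Rightarrow> real" where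
  "r_frak p c s = (LEAST y0. bdd_below (right_values (E_eq p c) s y0))"

text \<open>Local pullback attractivity of a solution on \<open>(-\<infinity>, \<beta>)\<close>. Existence on \<open>[s, s0]\<close> is
  required for \<open>|y0 - a s| \<le> \<delta>\<close>, not just \<open>< \<delta>\<close>, since the maximum is taken over the
  closed interval; shrinking \<open>\<delta>\<close> shows that this makes no difference. The supremum is then a
  maximum when \<open>s \<le> t \<le> s0\<close>, by continuous dependence on \<open>y0\<close>.\<close>

definition locally_pullback_attractive ::
    "(real \<Rightarrow> real \<Rightarrow> real) \<Rightarrow> ereal \<Rightarrow> (real \<Rightarrow> real) \<Rightarrow> bool" where
  "locally_pullback_attractive h \<beta> a \<longleftrightarrow>
     ode_solution h {t. ereal t < \<beta>} a \<and>
     (\<exists>s0 \<delta>. ereal s0 < \<beta> \<and> \<delta> > 0 \<and>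
        (\<forall>s\<le>s0. \<forall>y0. \<bar>y0 - a s\<bar> \<le> \<delta> \<longrightarrow> {s..s0} \<subseteq> max_interval h s y0) \<and>
        (\<forall>t\<le>s0. ((\<lambda>s. SUP y0\<in>{a s - \<delta>..a s + \<delta>}. \<bar>a t - max_sol h t s y0\<bar>)
                   \<longlongrightarrow> 0) at_bot))"

definition locally_pullback_repulsive ::
    "(real \<Rightarrow> real \<Rightarrow> real) \<Rightarrow> ereal \<Rightarrow> (real \<Rightarrow> real) \<Rightarrow> bool" where
  "locally_pullback_repulsive h \<alpha> r \<longleftrightarrow>
     locally_pullback_attractive (\<lambda>t y. - h (- t) y) (- \<alpha>) (\<lambda>t. r (- t))"

end

theory Submission
  imports Defs
begin

text \<open>
  Write \<open>\<gamma> t = 2 / pi * arctan (c * t)\<close>, and let \<open>a > r\<close> be the attractive and the repulsive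
  hyperbolic solution of \<open>x' = - x\<^sup>2 + p\<close>. Two structures of Riccati equations carry the proof.

  First, one solution determines all others. If \<open>b\<close> is a solution on the line,
  \<open>q' = 2 * (b - \<gamma>)\<close> and \<open>H' = exp (- q)\<close>, then \<open>b + exp (- q) / H\<close> is a solution wherever \<open>H\<close> does
  not vanish (\<open>riccati_family_solution\<close>). The constant of integration in \<open>H\<close> can be matched to any
  initial value other than that of \<open>b\<close>, so by uniqueness (\<open>riccati_unique\<close>) every other solution has this form. As \<open>H\<close> increases strictly, a solution above \<open>b\<close> exists up to
  \<open>+\<infinity>\<close>, a solution below \<open>b\<close> exists down to \<open>-\<infinity>\<close>, and the only way not to exist on the
  whole line is a blow-up at the zero of \<open>H\<close>. Solutions on the line are automatically bounded
  (\<open>riccati_global_bounded\<close>), so uniqueness of the bounded solution forces every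
  solution above \<open>b\<close> to blow up in the past and every solution below \<open>b\<close> to blow up in the future.

  Second, the coordinate \<open>\<phi> = (y - \<gamma> - r) / (a - r)\<close> sends the two hyperbolic solutions, translated
  by \<open>\<gamma>\<close>, to \<open>0\<close> and \<open>1\<close>, and turns the equation into
  \<open>\<phi>' = (a - r) * \<phi> * (1 - \<phi>) - \<gamma>' / (a - r)\<close>. This is a logistic equation whose rate \<open>a - r\<close> is
  bounded away from \<open>0\<close> (\<open>hyperbolic_gap\<close>) with a perturbation that tends to \<open>0\<close>. Hence \<open>\<phi>\<close>
  tends to \<open>0\<close> or to \<open>1\<close> along every solution for which it is bounded on the relevant side
  (\<open>perturbed_logistic_dichotomy\<close>), that is, the solution approaches one of the two translated
  hyperbolic solutions.

  For \<open>b\<close> the limit in the past is \<open>1\<close>: otherwise \<open>b\<close> would be repulsive in the past, and a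
  solution slightly above \<open>b\<close> would exist on the whole line (\<open>\<phi>_b_at_bot\<close>). By the symmetry
  \<open>y t \<mapsto> - y (- t)\<close>, which exchanges \<open>a\<close> with \<open>r\<close> and past with future, the limit in the future is
  \<open>0\<close>. The rest follows from these two limits: near \<open>\<phi> = 1\<close> the logistic equation contracts
  exponentially, which gives the pullback attraction of \<open>b\<close>, and a solution above \<open>b\<close> cannot share
  the limit \<open>0\<close> in the future because \<open>0\<close> repels, so that its limit is \<open>1\<close>. The remaining
  assertions are the mirror images.
\<close>

section \<open>Barriers and growth for scalar functions\<close>

lemma nondecreasing_if_derivative_nonneg:
  fixes f f' :: "real \<Rightarrow> real"
  assumes "a \<le> b"
    and "\<And>x. a \<le> x \<Longrightarrow> x \<le> b \<Longrightarrow> (f has_real_derivative f' x) (at x)"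
    and "\<And>x. a \<le> x \<Longrightarrow> x \<le> b \<Longrightarrow> f' x \<ge> 0"
  shows "f a \<le> f b"
  by (rule DERIV_nonneg_imp_nondecreasing[OF assms(1)]) (use assms(2,3) in blast)

text \<open>At the last time before \<open>t2\<close> at which \<open>f \<ge> l\<close>, the function would equal \<open>l\<close> and be strictly increasing.\<close>

lemma trapped_above:
  fixes f f' :: "real \<Rightarrow> real"
  assumes der: "\<And>t. t1 \<le> t \<Longrightarrow> t \<le> t2 \<Longrightarrow> (f has_real_derivative f' t) (at t)"
    and cross: "\<And>t. t1 \<le> t \<Longrightarrow> t \<le> t2 \<Longrightarrow> f t = l \<Longrightarrow> f' t > 0"
    and "f t1 \<ge> l" "t1 \<le> t2"
  shows "f t2 \<ge> l"
proof (rule ccontr)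
  assume "\<not> f t2 \<ge> l"
  then have lt: "f t2 < l" by simp
  have cont: "continuous_on {t1..t2} f"
    by (intro continuous_at_imp_continuous_on) (auto intro!: DERIV_isCont[OF der])
  define S where "S = {t\<in>{t1..t2}. f t \<ge> l}"
  have S: "compact S" "S \<noteq> {}"
  proof -
    have "S = {t1..t2} \<inter> f -` {l..}" by (auto simp: S_def)
    moreover have "closed ({t1..t2} \<inter> f -` {l..})"
      by (intro continuous_closed_preimage cont) auto
    ultimately show "compact S"
      by (metis Int_lower1 bounded_closed_interval bounded_subset compact_eq_bounded_closed)
    show "S \<noteq> {}" using assms by (auto simp: S_def)
  qed
  obtain \<tau> where \<tau>: "\<tau> \<in> S" and \<tau>max: "\<And>t. t \<in> S \<Longrightarrow> t \<le> \<tau>"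
    using compact_attains_sup[OF S] by blast
  have \<tau>1: "t1 \<le> \<tau>" "\<tau> < t2" "f \<tau> \<ge> l" using \<tau> lt by (auto simp: S_def less_le)
  have "f \<tau> = l"
  proof (rule ccontr)
    assume "f \<tau> \<noteq> l"
    then have "f \<tau> > l" using \<tau>1 by simp
    moreover have "continuous_on {\<tau>..t2} f"
      using cont by (rule continuous_on_subset) (use \<tau>1 in auto)
    ultimately obtain u where "\<tau> \<le> u" "u \<le> t2" "f u = l"
      using IVT2'[of f t2 l \<tau>] lt \<tau>1 by auto
    moreover from this have "u \<le> \<tau>" using \<tau>1 by (intro \<tau>max) (auto simp: S_def)
    ultimately show False using \<open>f \<tau> > l\<close> by simp
  qed
  then have "f' \<tau> > 0" using cross \<tau>1 by simp
  then obtain e where e: "e > 0" "\<And>h. 0 < h \<Longrightarrow> h < e \<Longrightarrow> f \<tau> < f (\<tau> + h)"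
    using DERIV_pos_inc_right[OF der] \<tau>1 by (metis less_imp_le)
  define h where "h = min (e / 2) (t2 - \<tau>)"
  have h: "0 < h" "h < e" "\<tau> + h \<le> t2" using e \<tau>1 by (auto simp: h_def min_def)
  then have "\<tau> + h \<in> S" using e(2)[of h] \<open>f \<tau> = l\<close> \<tau>1 by (auto simp: S_def)
  then show False using \<tau>max h by fastforce
qed

text \<open>Between the barriers \<open>l\<close> and \<open>u\<close> the function climbs at a definite speed, so it must reach \<open>u\<close>; then \<open>u\<close> itself is a
  barrier.\<close>

lemma eventually_above:
  fixes f f' :: "real \<Rightarrow> real"
  assumes der: "\<And>t. t1 \<le> t \<Longrightarrow> (f has_real_derivative f' t) (at t)"
    and rate: "\<And>t. t1 \<le> t \<Longrightarrow> l \<le> f t \<Longrightarrow> f t \<le> u \<Longrightarrow> f' t \<ge> \<kappa>"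
    and "\<kappa> > 0" "f t1 \<ge> l" "l \<le> u"
  shows "\<forall>\<^sub>F t in at_top. f t \<ge> u"
proof -
  have lower: "f t \<ge> l" if "t \<ge> t1" for t
  proof (rule trapped_above[of t1 t f f' l])
    show "f' x > 0" if "t1 \<le> x" "x \<le> t" "f x = l" for x
    proof -
      have "\<kappa> \<le> f' x" by (rule rate) (use assms  that in auto)
      with \<open>\<kappa> > 0\<close> show ?thesis by simp
    qed
  qed (use assms that in auto)
  have "\<exists>t\<ge>t1. f t \<ge> u"
  proof (rule ccontr)
    assume no: "\<not> (\<exists>t\<ge>t1. f t \<ge> u)"
    define t where "t = t1 + (u - l) / \<kappa>"
    have t: "t \<ge> t1" using assms by (simp add: t_def)
    have "f t1 - \<kappa> * t1 \<le> f t - \<kappa> * t"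
    proof (rule DERIV_nonneg_imp_nondecreasing[OF t])
      fix x assume x: "t1 \<le> x" "x \<le> t"
      then have "f x < u" using no by force
      then have "f' x \<ge> \<kappa>" using rate[OF x(1)] lower[OF x(1)] by simp
      moreover have "((\<lambda>x. f x - \<kappa> * x) has_real_derivative f' x - \<kappa>) (at x)"
        by (auto intro!: derivative_eq_intros der x)
      ultimately show "\<exists>y. ((\<lambda>x. f x - \<kappa> * x) has_real_derivative y) (at x) \<and> 0 \<le> y"
        by (intro exI[of _ "f' x - \<kappa>"]) simp
    qed
    moreover have "\<kappa> * t = \<kappa> * t1 + (u - l)" using assms by (simp add: t_def field_simps)
    ultimately have "f t \<ge> u" using assms by simp
    then show False using no t by blast
  qed
  then obtain t2 where t2: "t2 \<ge> t1" "f t2 \<ge> u" by blast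
  have "f t \<ge> u" if "t \<ge> t2" for t
  proof (rule trapped_above[of t2 t f f' u])
    show "f' x > 0" if "t2 \<le> x" "x \<le> t" "f x = u" for x
    proof -
      have "\<kappa> \<le> f' x" by (rule rate) (use assms t2 that in auto)
      with \<open>\<kappa> > 0\<close> show ?thesis by simp
    qed
  qed (use der t2 that in auto)
  then show ?thesis unfolding eventually_at_top_linorder by blast
qed

text \<open>Above the level \<open>M\<close> the growth is quadratic, so that \<open>- 1 / (f - m)\<close> increases at speed at least
  \<open>1 / 2\<close> and would reach \<open>0\<close> in finite time.\<close>

lemma quadratic_growth_bound:
  fixes f f' :: "real \<Rightarrow> real"
  assumes der: "\<And>t. t \<ge> t0 \<Longrightarrow> (f has_real_derivative f' t) (at t)"
    and rate: "\<And>t. t \<ge> t0 \<Longrightarrow> f t \<ge> M \<Longrightarrow> f' t \<ge> (f t - m)\<^sup>2 / 2"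
    and "m < M"
  shows "f t0 < M"
proof (rule ccontr)
  assume *: "\<not> f t0 < M"
  have low: "f t \<ge> M" if "t \<ge> t0" for t
  proof (rule trapped_above[of t0 t f f'])
    show "f' x > 0" if "t0 \<le> x" "x \<le> t" "f x = M" for x
    proof -
      have "f' x \<ge> (f x - m)\<^sup>2 / 2" by (rule rate) (use that in auto)
      moreover have "(f x - m)\<^sup>2 > 0" using that \<open>m < M\<close> by simp
      ultimately show ?thesis by linarith
    qed
  qed (use * that der in auto)
  define t where "t = t0 + 2 / (f t0 - m)"
  have pos: "f t0 - m > 0" using * \<open>m < M\<close> by simp
  then have t: "t0 \<le> t" by (simp add: t_def)
  have "- 1 / (f t0 - m) - t0 / 2 \<le> - 1 / (f t - m) - t / 2"
  proof (rule nondecreasing_if_derivative_nonneg[OF t, where f' = "\<lambda>t. f' t / (f t - m)\<^sup>2 - 1 / 2"])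
    fix x assume x: "t0 \<le> x" "x \<le> t"
    have nz: "f x - m > 0" using low[OF x(1)] \<open>m < M\<close> by simp
    then show "((\<lambda>x. - 1 / (f x - m) - x / 2) has_real_derivative f' x / (f x - m)\<^sup>2 - 1 / 2) (at x)"
      using der[OF x(1)] by (auto intro!: derivative_eq_intros simp: power2_eq_square)
    show "0 \<le> f' x / (f x - m)\<^sup>2 - 1 / 2"
      using rate[OF x(1) low[OF x(1)]] nz by (simp add: field_simps)
  qed
  moreover have "t / 2 = t0 / 2 + 1 / (f t0 - m)" by (simp add: t_def field_simps)
  ultimately have "0 \<le> - 1 / (f t - m)" by simp
  moreover have "f t - m > 0" using low[OF t] \<open>m < M\<close> by simp
  ultimately show False by (simp add: divide_simps)
qed

lemma exponential_decay_at_bot: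
  fixes \<beta> k t :: real
  assumes "\<beta> > 0"
  shows "((\<lambda>s. k * exp (- \<beta> * (t - s))) \<longlongrightarrow> 0) at_bot"
proof -
  have "filterlim (\<lambda>s. - \<beta> * (t - s)) at_bot at_bot"
    unfolding filterlim_at_bot eventually_at_bot_linorder
  proof
    fix Z
    have "- \<beta> * (t - s) \<le> Z" if "s \<le> t + Z / \<beta>" for s
      using that \<open>\<beta> > 0\<close> by (simp add: field_simps)
    then show "\<exists>N. \<forall>s\<le>N. - \<beta> * (t - s) \<le> Z" by blast
  qed
  then have "((\<lambda>s. k * exp (- \<beta> * (t - s))) \<longlongrightarrow> k * 0) at_bot"
    by (intro tendsto_mult tendsto_const filterlim_compose[OF exp_at_bot])
  then show ?thesis by simp
qed

lemma exponential_decay_at_top: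
  fixes \<beta> k t :: real
  assumes "\<beta> > 0"
  shows "((\<lambda>s. k * exp (- \<beta> * (s - t))) \<longlongrightarrow> 0) at_top"
  using filterlim_compose[OF exponential_decay_at_bot[OF assms, of k "- t"] filterlim_uminus_at_bot_at_top]
  by simp

section \<open>The logistic equation with a vanishing perturbation\<close>

text \<open>For a small margin \<open>\<eta>\<close>, the perturbation is eventually dominated by the logistic term outside the
  \<open>\<eta>\<close>-neighbourhoods of the equilibria \<open>0\<close> and \<open>1\<close>. Below \<open>- \<eta>\<close> the function would decrease
  without bound, above \<open>1 + \<eta>\<close> it decreases, and in between it increases towards \<open>1 - \<eta>\<close>.
  So it either stays near \<open>0\<close> for all margins or is eventually captured near \<open>1\<close>. The lower bound
  excludes escape to \<open>- \<infinity>\<close>, the only other behaviour.\<close>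

lemma perturbed_logistic_dichotomy:
  fixes \<phi> d \<epsilon> :: "real \<Rightarrow> real"
  assumes der: "\<And>t. t \<ge> T \<Longrightarrow>
        (\<phi> has_real_derivative d t * \<phi> t * (1 - \<phi> t) - \<epsilon> t) (at t)"
    and d: "\<And>t. d t \<ge> \<delta>" "\<delta> > 0"
    and \<epsilon>: "(\<epsilon> \<longlongrightarrow> 0) at_top"
    and lower: "\<And>t. t \<ge> T \<Longrightarrow> \<phi> t \<ge> L"
  shows "(\<phi> \<longlongrightarrow> 0) at_top \<or> (\<phi> \<longlongrightarrow> 1) at_top"
proof -
  have dpos: "d t > 0" for t using d(1)[of t] d(2) by simp
  have small: "\<exists>T'\<ge>T. \<forall>t\<ge>T'. \<bar>\<epsilon> t\<bar> < \<delta> * \<eta> / 4" if "\<eta> > 0" for \<eta>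
  proof -
    have "\<forall>\<^sub>F t in at_top. \<bar>\<epsilon> t\<bar> < \<delta> * \<eta> / 4"
      using tendstoD[OF \<epsilon>, of "\<delta> * \<eta> / 4"] that d by (simp add: dist_real_def)
    then obtain N where "\<forall>t\<ge>N. \<bar>\<epsilon> t\<bar> < \<delta> * \<eta> / 4" unfolding eventually_at_top_linorder by blast
    then show ?thesis by (intro exI[of _ "max N T"]) auto
  qed
  have der': "((\<lambda>t. - \<phi> t) has_real_derivative d t * (- \<phi> t) * (1 - \<phi> t) + \<epsilon> t) (at t)"
    if "t \<ge> T" for t
    using DERIV_minus[OF der[OF that]] by simp
  \<comment> \<open>a value at most \<open>- \<eta>\<close> at a late time would force \<open>\<phi>\<close> below its lower bound\<close>
  have low: "\<forall>\<^sub>F t in at_top. \<phi> t > - \<eta>" if \<eta>: "\<eta> > 0" for \<eta>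
  proof -
    obtain T' where T': "T' \<ge> T" "\<And>t. t \<ge> T' \<Longrightarrow> \<bar>\<epsilon> t\<bar> < \<delta> * \<eta> / 4" using small[OF \<eta>] by blast
    have "\<phi> t1 > - \<eta>" if t1: "t1 \<ge> T'" for t1
    proof (rule ccontr)
      assume "\<not> \<phi> t1 > - \<eta>"
      then have "\<forall>\<^sub>F t in at_top. - \<phi> t \<ge> \<bar>L\<bar> + \<eta> + 1"
      proof (intro eventually_above[where f' = "\<lambda>t. d t * (- \<phi> t) * (1 - \<phi> t) + \<epsilon> t"
              and l = \<eta> and \<kappa> = "\<delta> * \<eta> / 4" and ?t1.0 = t1])
        fix t assume t: "t1 \<le> t" "\<eta> \<le> - \<phi> t"
        have "\<delta> * \<eta> \<le> d t * (- \<phi> t)" using d t \<eta> less_imp_le[OF dpos] by (intro mult_mono) auto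
        also have "\<dots> \<le> d t * (- \<phi> t) * (1 - \<phi> t)"
          using dpos[of t] t \<eta> mult_left_mono[of 1 "1 - \<phi> t" "d t * (- \<phi> t)"]
          by (simp add: mult_nonneg_nonpos)
        finally show "\<delta> * \<eta> / 4 \<le> d t * (- \<phi> t) * (1 - \<phi> t) + \<epsilon> t"
          using T'(2)[of t] t t1 d \<eta> by (auto simp: abs_if split: if_splits)
      qed (use \<eta> d t1 T' der' in auto)
      then obtain N where "\<forall>t\<ge>N. - \<phi> t \<ge> \<bar>L\<bar> + \<eta> + 1" unfolding eventually_at_top_linorder by blast
      from this[rule_format, of "max N T"] lower[of "max N T"] \<eta> show False by simp
    qed
    then show ?thesis unfolding eventually_at_top_linorder by blast
  qed
  have up: "\<forall>\<^sub>F t in at_top. \<phi> t \<le> 1 + \<eta>" if \<eta>: "\<eta> > 0" for \<eta>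
  proof -
    obtain T' where T': "T' \<ge> T" "\<And>t. t \<ge> T' \<Longrightarrow> \<bar>\<epsilon> t\<bar> < \<delta> * \<eta> / 4" using small[OF \<eta>] by blast
    have "\<forall>\<^sub>F t in at_top. - \<phi> t \<ge> - 1 - \<eta>"
    proof (intro eventually_above[where f' = "\<lambda>t. d t * (- \<phi> t) * (1 - \<phi> t) + \<epsilon> t"
            and l = "min (- \<phi> T') (- 1 - \<eta>)" and \<kappa> = "\<delta> * \<eta> / 4" and ?t1.0 = T'])
      fix t assume t: "T' \<le> t" "- \<phi> t \<le> - 1 - \<eta>"
      have "\<delta> * \<eta> \<le> d t * (\<phi> t - 1)" using d t \<eta> less_imp_le[OF dpos] by (intro mult_mono) auto
      also have "\<dots> \<le> d t * (\<phi> t - 1) * \<phi> t"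
        using dpos[of t] t \<eta> mult_left_mono[of 1 "\<phi> t" "d t * (\<phi> t - 1)"] by simp
      also have "\<dots> = d t * (- \<phi> t) * (1 - \<phi> t)" by (simp add: algebra_simps)
      finally show "\<delta> * \<eta> / 4 \<le> d t * (- \<phi> t) * (1 - \<phi> t) + \<epsilon> t"
        using T'(2)[of t] t d \<eta> by (auto simp: abs_if split: if_splits)
    qed (use \<eta> d T' der' in auto)
    then show ?thesis by eventually_elim simp
  qed
  show ?thesis
  proof (rule disjCI)
    assume "\<not> (\<phi> \<longlongrightarrow> 1) at_top"
    \<comment> \<open>values at least \<open>\<eta>\<close> at arbitrarily late times lead to capture near \<open>1\<close>\<close>
    have far: "\<forall>\<^sub>F t in at_top. \<phi> t < \<eta>" if \<eta>: "0 < \<eta>" for \<eta>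
    proof (rule ccontr)
      assume fr: "\<not> (\<forall>\<^sub>F t in at_top. \<phi> t < \<eta>)"
      have "(\<phi> \<longlongrightarrow> 1) at_top"
      proof (rule tendstoI)
        fix e :: real assume e: "e > 0"
        define \<mu> where "\<mu> = min (min (e / 2) (1 / 2)) \<eta>"
        have \<mu>: "\<mu> > 0" "\<mu> < e" "\<mu> \<le> 1 / 2" "\<mu> \<le> \<eta>" using e \<eta> by (auto simp: \<mu>_def min_def)
        obtain T' where T': "T' \<ge> T" "\<And>t. t \<ge> T' \<Longrightarrow> \<bar>\<epsilon> t\<bar> < \<delta> * \<mu> / 4" using small[OF \<mu>(1)] by blast
        obtain t1 where t1: "t1 \<ge> T'" "\<phi> t1 \<ge> \<eta>"
          using fr unfolding eventually_at_top_linorder by (auto simp: not_less)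
        have "\<forall>\<^sub>F t in at_top. \<phi> t \<ge> 1 - \<mu>"
        proof (intro eventually_above[where f' = "\<lambda>t. d t * \<phi> t * (1 - \<phi> t) - \<epsilon> t"
            and l = \<mu> and \<kappa> = "\<delta> * \<mu> / 4" and ?t1.0 = t1])
          fix t assume t: "t1 \<le> t" "\<mu> \<le> \<phi> t" "\<phi> t \<le> 1 - \<mu>"
          have "0 \<le> (\<phi> t - \<mu>) * (1 - \<mu> - \<phi> t)" using t by simp
          then have *: "\<mu> * (1 - \<mu>) \<le> \<phi> t * (1 - \<phi> t)" by (simp add: algebra_simps)
          have "\<delta> * \<mu> / 2 \<le> \<delta> * (\<mu> * (1 - \<mu>))" using d \<mu> by (simp add: field_simps)
          also have "\<dots> \<le> d t * (\<phi> t * (1 - \<phi> t))"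
            using \<mu> by (intro mult_mono[OF d(1) *]) (auto simp: less_imp_le[OF dpos])
          finally have "\<delta> * \<mu> / 2 \<le> d t * \<phi> t * (1 - \<phi> t)" by (simp add: mult.assoc)
          moreover have "\<delta> * \<mu> > 0" using d \<mu> by simp
          moreover have "\<bar>\<epsilon> t\<bar> < \<delta> * \<mu> / 4" using T'(2)[of t] t t1 by simp
          ultimately show "\<delta> * \<mu> / 4 \<le> d t * \<phi> t * (1 - \<phi> t) - \<epsilon> t" by linarith
        qed (use \<mu> d t1 T' der in auto)
        then show "\<forall>\<^sub>F t in at_top. dist (\<phi> t) 1 < e" using up[OF \<mu>(1)]
          by eventually_elim (use \<mu> in \<open>auto simp: dist_real_def\<close>)
      qed
      then show False using \<open>\<not> (\<phi> \<longlongrightarrow> 1) at_top\<close> by blast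
    qed
    show "(\<phi> \<longlongrightarrow> 0) at_top"
    proof (rule tendstoI)
      fix e :: real assume e: "e > 0"
      show "\<forall>\<^sub>F t in at_top. dist (\<phi> t) 0 < e" using far[OF e] low[OF e]
        by eventually_elim (auto simp: dist_real_def)
    qed
  qed
qed

section \<open>Uniqueness and maximal solutions\<close>

definition unique_solutions :: "(real \<Rightarrow> real \<Rightarrow> real) \<Rightarrow> bool" where
  "unique_solutions h \<longleftrightarrow> (\<forall>s y0 J x J' x' t. ivp_solution h s y0 J x \<longrightarrow> ivp_solution h s y0 J' x' \<longrightarrow>
     t \<in> J \<longrightarrow> t \<in> J' \<longrightarrow> x t = x' t)"

lemma ode_solutionD:
  "ode_solution h J x \<Longrightarrow> t \<in> J \<Longrightarrow> (x has_real_derivative h t (x t)) (at t)"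
  by (simp add: ode_solution_def)

lemma ode_solution_continuous: "ode_solution h J x \<Longrightarrow> continuous_on J x"
  by (meson DERIV_isCont continuous_at_imp_continuous_on ode_solutionD)

lemma ivp_solutionD:
  assumes "ivp_solution h s y0 J x"
  shows "open J" "is_interval J" "s \<in> J" "ode_solution h J x" "x s = y0"
  using assms by (auto simp: ivp_solution_def)

lemma max_sol_eq:
  assumes "unique_solutions h" "ivp_solution h s y0 J x" "t \<in> J"
  shows "max_sol h t s y0 = x t"
  unfolding max_sol_def
  by (rule the_equality) (use assms in \<open>unfold unique_solutions_def, blast+\<close>)

text \<open>All local solutions agree where they overlap, so they glue to a solution on the union of their intervals.\<close>

lemma ivp_solution_max:
  assumes u: "unique_solutions h" and ex: "s \<in> max_interval h s y0"
  shows "ivp_solution h s y0 (max_interval h s y0) (\<lambda>t. max_sol h t s y0)"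
  unfolding ivp_solution_def
proof (intro conjI)
  let ?I = "max_interval h s y0"
  show "open ?I" unfolding max_interval_def by (auto dest: ivp_solutionD)
  show "is_interval ?I"
    unfolding is_interval_1
  proof (intro ballI allI impI)
    fix a b t assume "a \<in> ?I" "b \<in> ?I" and t: "a \<le> t \<and> t \<le> b"
    then obtain J x K y where J: "ivp_solution h s y0 J x" "a \<in> J" and K: "ivp_solution h s y0 K y" "b \<in> K"
      unfolding max_interval_def by blast
    have "t \<in> J \<or> t \<in> K"
    proof (cases "t \<le> s")
      case True
      have "s \<in> J" "is_interval J" using J(1) by (auto dest: ivp_solutionD)
      then show ?thesis using J(2) t True unfolding is_interval_1 by blast
    next
      case False
      have "s \<in> K" "is_interval K" using K(1) by (auto dest: ivp_solutionD)
      then show ?thesis using K(2) t False unfolding is_interval_1 by (meson linear)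
    qed
    then show "t \<in> ?I" using J K unfolding max_interval_def by blast
  qed
  show "s \<in> ?I" by (rule ex)
  obtain J x where J: "ivp_solution h s y0 J x" using ex unfolding max_interval_def by blast
  show "max_sol h s s y0 = y0"
    using max_sol_eq[OF u J] J by (auto dest: ivp_solutionD)
  show "ode_solution h ?I (\<lambda>t. max_sol h t s y0)"
    unfolding ode_solution_def
  proof
    fix t assume "t \<in> ?I"
    then obtain J x where J: "ivp_solution h s y0 J x" "t \<in> J" unfolding max_interval_def by blast
    have "(x has_real_derivative h t (max_sol h t s y0)) (at t)"
      using ode_solutionD[OF ivp_solutionD(4)[OF J(1)] J(2)] max_sol_eq[OF u J] by simp
    then show "((\<lambda>t. max_sol h t s y0) has_real_derivative h t (max_sol h t s y0)) (at t)"
      by (rule has_field_derivative_transform_within_open[of _ _ _ J])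
        (use J max_sol_eq[OF u J(1)] in \<open>auto dest: ivp_solutionD\<close>)
  qed
qed

lemma max_intervalI: "ivp_solution h s y0 J x \<Longrightarrow> t \<in> J \<Longrightarrow> t \<in> max_interval h s y0"
  unfolding max_interval_def by blast

section \<open>Riccati equations and their one-parameter families of solutions\<close>

text \<open>Both the equation of the theorem and its two limit equations have this form; the base equation is the case \<open>\<gamma> = 0\<close>.\<close>

definition riccati :: "(real \<Rightarrow> real) \<Rightarrow> (real \<Rightarrow> real) \<Rightarrow> real \<Rightarrow> real \<Rightarrow> real" where
  "riccati \<gamma> p t y = - ((y - \<gamma> t)\<^sup>2) + p t"

lemma continuous_has_antiderivative:
  fixes f :: "real \<Rightarrow> real"
  assumes "continuous_on UNIV f"
  obtains F where "\<And>t. (F has_real_derivative f t) (at t)"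
proof -
  have "\<exists>F. \<forall>x::real. -\<infinity> < ereal x \<longrightarrow> ereal x < \<infinity> \<longrightarrow> (F has_vector_derivative f x) (at x)"
    using assms by (intro einterval_antiderivative) (auto simp: continuous_on_eq_continuous_at)
  then show ?thesis using that by (auto simp: has_real_derivative_iff_has_vector_derivative)
qed

lemma linear_equation_zero:
  fixes f m :: "real \<Rightarrow> real"
  assumes J: "is_interval J" "s \<in> J" "t \<in> J"
    and der: "\<And>u. u \<in> J \<Longrightarrow> (f has_real_derivative m u * f u) (at u)"
    and m: "continuous_on J m" and "f s = 0"
  shows "f t = 0"
proof -
  define K where "K = {min s t..max s t}"
  have "s \<in> K" "t \<in> K" by (auto simp: K_def)
  moreover have "min s t \<in> J" "max s t \<in> J" using J by (simp_all add: min_def max_def)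
  then have "K \<subseteq> J" using J(1) unfolding K_def is_interval_1 by (meson atLeastAtMost_iff subsetI)
  ultimately have K: "K \<subseteq> J" "s \<in> K" "t \<in> K" by blast+
  obtain g where g: "\<And>x. x \<in> K \<Longrightarrow> (g has_real_derivative m x) (at x within K)"
  proof (rule antiderivative_continuous)
    show "continuous_on {min s t..max s t} m"
      using continuous_on_subset[OF m K(1)] by (simp add: K_def)
  qed (use that in \<open>auto simp: K_def has_real_derivative_iff_has_vector_derivative\<close>)
  have "((\<lambda>x. f x * exp (- g x)) has_real_derivative 0) (at x within K)" if "x \<in> K" for x
  proof -
    have "(f has_real_derivative m x * f x) (at x within K)"
      using has_field_derivative_at_within[OF der] K that by blast
    from DERIV_mult[OF this DERIV_chain'[OF DERIV_minus[OF g[OF that]] DERIV_exp]] show ?thesis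
      by (simp add: algebra_simps)
  qed
  moreover have "convex K" by (simp add: K_def)
  ultimately obtain c where c: "\<forall>x\<in>K. f x * exp (- g x) = c"
    using has_field_derivative_zero_constant[of K "\<lambda>x. f x * exp (- g x)"] by blast
  have "c = f s * exp (- g s)" "c = f t * exp (- g t)" using c K by simp_all
  with \<open>f s = 0\<close> show ?thesis by simp
qed

text \<open>The difference of two solutions solves a homogeneous linear equation, because
  \<open>(x - \<gamma>)\<^sup>2 - (y - \<gamma>)\<^sup>2 = (x + y - 2 * \<gamma>) * (x - y)\<close>.\<close>

lemma riccati_unique:
  assumes \<gamma>: "continuous_on UNIV \<gamma>"
  shows "unique_solutions (riccati \<gamma> p)"
  unfolding unique_solutions_def
proof (intro allI impI)
  fix s y0 J x J' x' t
  assume x: "ivp_solution (riccati \<gamma> p) s y0 J x" and x': "ivp_solution (riccati \<gamma> p) s y0 J' x'"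
    and t: "t \<in> J" "t \<in> J'"
  note X = ivp_solutionD[OF x] and X' = ivp_solutionD[OF x']
  have "x t - x' t = 0"
  proof (rule linear_equation_zero[of "J \<inter> J'" s t "\<lambda>t. x t - x' t" "\<lambda>t. - (x t + x' t - 2 * \<gamma> t)"])
    show "((\<lambda>t. x t - x' t) has_real_derivative - (x u + x' u - 2 * \<gamma> u) * (x u - x' u)) (at u)"
      if "u \<in> J \<inter> J'" for u
      using ode_solutionD[OF X(4)] ode_solutionD[OF X'(4)] that
      by (auto intro!: derivative_eq_intros simp: riccati_def power2_eq_square algebra_simps)
    show "continuous_on (J \<inter> J') (\<lambda>t. - (x t + x' t - 2 * \<gamma> t))"
      by (intro continuous_intros continuous_on_subset[OF ode_solution_continuous[OF X(4)]]
          continuous_on_subset[OF ode_solution_continuous[OF X'(4)]] continuous_on_subset[OF \<gamma>]) auto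
  qed (use t X X' in \<open>auto intro: is_interval_Int\<close>)
  then show "x t = x' t" by simp
qed

lemma distinct_solutions:
  assumes \<gamma>: "continuous_on UNIV \<gamma>"
    and x: "ode_solution (riccati \<gamma> p) UNIV x" and y: "ode_solution (riccati \<gamma> p) UNIV y" and "x s = y s"
  shows "x = y"
proof
  fix t
  have "ivp_solution (riccati \<gamma> p) s (x s) UNIV x" "ivp_solution (riccati \<gamma> p) s (x s) UNIV y"
    using x y \<open>x s = y s\<close> by (auto simp: ivp_solution_def)
  then show "x t = y t" using riccati_unique[OF \<gamma>, of p] unfolding unique_solutions_def by blast
qed

lemma riccati_exponent:
  assumes "ode_solution (riccati \<gamma> p) UNIV b" and "continuous_on UNIV \<gamma>"
  obtains q where "\<And>t. (q has_real_derivative 2 * (b t - \<gamma> t)) (at t)"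
proof -
  have "continuous_on UNIV (\<lambda>t. 2 * (b t - \<gamma> t))"
    by (intro continuous_intros assms ode_solution_continuous[OF assms(1)])
  then show ?thesis using continuous_has_antiderivative that by blast
qed

lemma exp_primitive:
  fixes q q' :: "real \<Rightarrow> real"
  assumes "\<And>t. (q has_real_derivative q' t) (at t)"
  obtains H where "\<And>t. (H has_real_derivative exp (- q t)) (at t)" "H s = v"
proof -
  have "continuous_on UNIV q" by (meson DERIV_isCont assms continuous_at_imp_continuous_on)
  then have "continuous_on UNIV (\<lambda>t. exp (- q t))" by (intro continuous_intros)
  then obtain G where "\<And>t. (G has_real_derivative exp (- q t)) (at t)"
    using continuous_has_antiderivative by blast
  then have "\<And>t. ((\<lambda>t. G t + (v - G s)) has_real_derivative exp (- q t)) (at t)"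
    by (auto intro!: derivative_eq_intros)
  then show ?thesis using that[of "\<lambda>t. G t + (v - G s)"] by simp
qed

lemma exp_primitive_strict_mono:
  assumes H: "\<And>t. (H has_real_derivative exp (- q t)) (at t)" and "s < t"
  shows "H s < (H t :: real)"
  by (rule DERIV_pos_imp_increasing[OF \<open>s < t\<close>]) (use H in \<open>auto intro!: exI\<close>)

lemma exp_primitive_mono:
  assumes H: "\<And>t. (H has_real_derivative exp (- q t)) (at t)" and "s \<le> t"
  shows "H s \<le> (H t :: real)"
  using exp_primitive_strict_mono[OF H, of s t] \<open>s \<le> t\<close> by (cases "s = t") auto

text \<open>The substitution \<open>y = b + 1 / w\<close> turns the Riccati equation into the linear equation
  \<open>w' = 2 * (b - \<gamma>) * w + 1\<close>, which \<open>w = H * exp q\<close> solves. The constant of integration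
  in \<open>H\<close> can be adjusted to any initial value other than that of \<open>b\<close>, so two integrations starting from \<open>b\<close> produce
  all solutions together with their domains.\<close>

lemma riccati_family_solution:
  assumes b: "ode_solution (riccati \<gamma> p) UNIV b"
    and q: "\<And>t. (q has_real_derivative 2 * (b t - \<gamma> t)) (at t)"
    and H: "\<And>t. (H has_real_derivative exp (- q t)) (at t)"
    and nz: "\<And>t. t \<in> J \<Longrightarrow> H t \<noteq> 0"
  shows "ode_solution (riccati \<gamma> p) J (\<lambda>t. b t + exp (- q t) / H t)"
  unfolding ode_solution_def
proof
  fix t assume "t \<in> J"
  with nz have nz: "H t \<noteq> 0" by blast
  have "((\<lambda>t. b t + exp (- q t) / H t) has_real_derivative
      riccati \<gamma> p t (b t) + (- (2 * (b t - \<gamma> t)) * exp (- q t) * H t - exp (- q t) * exp (- q t)) / (H t * H t)) (at t)"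
    using ode_solutionD[OF b, of t] q[of t] H[of t] nz
    by (auto intro!: derivative_eq_intros)
  also have "riccati \<gamma> p t (b t) + (- (2 * (b t - \<gamma> t)) * exp (- q t) * H t - exp (- q t) * exp (- q t)) / (H t * H t)
      = riccati \<gamma> p t (b t + exp (- q t) / H t)"
    using nz by (simp add: riccati_def power2_eq_square field_simps)
  finally show "((\<lambda>t. b t + exp (- q t) / H t) has_real_derivative riccati \<gamma> p t (b t + exp (- q t) / H t)) (at t)" .
qed

section \<open>Reflection of time and space\<close>

text \<open>The symmetry of Riccati equations that exchanges past and future, above and below, and attraction and repulsion.
  Statements about the future of solutions below \<open>b\<close> are obtained from statements about the past of solutions above
  \<open>b\<close> by applying it.\<close>

definition reflect :: "(real \<Rightarrow> real) \<Rightarrow> real \<Rightarrow> real" where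
  "reflect x t = - x (- t)"

lemma reflect_reflect [simp]: "reflect (reflect x) = x"
  by (simp add: reflect_def fun_eq_iff)

lemma DERIV_reflect:
  assumes "(x has_real_derivative y) (at (- t))"
  shows "(reflect x has_real_derivative y) (at t)"
  using DERIV_minus[OF assms[THEN DERIV_mirror[THEN iffD1]]]
  by (simp add: reflect_def[abs_def])

lemma ode_solution_reflect:
  assumes "ode_solution (riccati \<gamma> p) J x"
  shows "ode_solution (riccati (reflect \<gamma>) (\<lambda>t. p (- t))) (uminus ` J) (reflect x)"
  unfolding ode_solution_def
proof
  fix t assume "t \<in> uminus ` J"
  then have "- t \<in> J" by auto
  from DERIV_reflect[OF ode_solutionD[OF assms this]]
  show "(reflect x has_real_derivative riccati (reflect \<gamma>) (\<lambda>t. p (- t)) t (reflect x t)) (at t)"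
    by (simp add: riccati_def reflect_def power2_eq_square algebra_simps)
qed

lemma is_interval_uminus: "is_interval J \<Longrightarrow> is_interval (uminus ` J :: real set)"
  by (simp add: is_interval_minus_translation' image_comp)

lemma ivp_solution_reflect:
  assumes "ivp_solution (riccati \<gamma> p) s y0 J x"
  shows "ivp_solution (riccati (reflect \<gamma>) (\<lambda>t. p (- t))) (- s) (- y0) (uminus ` J) (reflect x)"
  using ivp_solutionD[OF assms] ode_solution_reflect[of \<gamma> p J x]
  by (simp add: ivp_solution_def reflect_def[of x] is_interval_uminus open_negations)

lemma max_interval_reflect:
  "max_interval (riccati (reflect \<gamma>) (\<lambda>t. p (- t))) (- s) (- y0) =
     uminus ` max_interval (riccati \<gamma> p) s y0" (is "?L = ?R")
proof
  show "?R \<subseteq> ?L"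
  proof
    fix t assume "t \<in> ?R"
    then obtain u where u: "t = - u" "u \<in> max_interval (riccati \<gamma> p) s y0" by blast
    then obtain J x where "ivp_solution (riccati \<gamma> p) s y0 J x" "u \<in> J"
      unfolding max_interval_def by blast
    then show "t \<in> ?L" using u(1) by (auto intro!: max_intervalI[OF ivp_solution_reflect])
  qed
  show "?L \<subseteq> ?R"
  proof
    fix t assume "t \<in> ?L"
    then obtain J x where J: "ivp_solution (riccati (reflect \<gamma>) (\<lambda>t. p (- t))) (- s) (- y0) J x" "t \<in> J"
      unfolding max_interval_def by blast
    have "- t \<in> max_interval (riccati \<gamma> p) s y0"
      using max_intervalI[OF ivp_solution_reflect[OF J(1)], of "- t"] J(2) by simp
    then show "t \<in> ?R" by (metis image_eqI minus_minus)
  qed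
qed

lemma continuous_on_reflect: "continuous_on UNIV x \<Longrightarrow> continuous_on UNIV (reflect x)"
  unfolding reflect_def[abs_def]
  by (rule continuous_on_minus, erule continuous_on_compose2) (auto intro: continuous_intros)

lemma max_sol_reflect:
  assumes \<gamma>: "continuous_on UNIV \<gamma>" and t: "t \<in> max_interval (riccati \<gamma> p) s y0"
  shows "max_sol (riccati (reflect \<gamma>) (\<lambda>t. p (- t))) (- t) (- s) (- y0) = - max_sol (riccati \<gamma> p) t s y0"
proof -
  obtain J x where J: "ivp_solution (riccati \<gamma> p) s y0 J x" "t \<in> J"
    using t unfolding max_interval_def by blast
  have "max_sol (riccati (reflect \<gamma>) (\<lambda>t. p (- t))) (- t) (- s) (- y0) = reflect x (- t)"
    by (rule max_sol_eq[OF riccati_unique[OF continuous_on_reflect[OF \<gamma>]] ivp_solution_reflect[OF J(1)]])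
      (use J in simp)
  then show ?thesis using max_sol_eq[OF riccati_unique[OF \<gamma>] J] by (simp add: reflect_def)
qed

lemma right_values_reflect:
  assumes \<gamma>: "continuous_on UNIV \<gamma>"
  shows "right_values (riccati \<gamma> p) s y0 =
    uminus ` left_values (riccati (reflect \<gamma>) (\<lambda>t. p (- t))) (- s) (- y0)"
proof -
  have "uminus ` max_interval (riccati \<gamma> p) s y0 \<inter> {..- s} =
      uminus ` (max_interval (riccati \<gamma> p) s y0 \<inter> {s..})"
    by auto
  then have "uminus ` left_values (riccati (reflect \<gamma>) (\<lambda>t. p (- t))) (- s) (- y0) =
     (\<lambda>t. - max_sol (riccati (reflect \<gamma>) (\<lambda>t. p (- t))) (- t) (- s) (- y0)) `
       (max_interval (riccati \<gamma> p) s y0 \<inter> {s..})"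
    unfolding left_values_def max_interval_reflect by (simp add: image_image)
  also have "\<dots> = right_values (riccati \<gamma> p) s y0"
    unfolding right_values_def by (intro image_cong) (simp_all add: max_sol_reflect[OF \<gamma>])
  finally show ?thesis ..
qed

section \<open>A priori bounds\<close>

text \<open>The level \<open>G + 1 + 2 * P\<close> is high enough for half of \<open>(y - G)\<^sup>2\<close> to absorb the inhomogeneity \<open>e\<close>.\<close>

lemma riccati_rate:
  fixes y c e :: real
  assumes "\<bar>c\<bar> \<le> G" "\<bar>e\<bar> \<le> P" "y \<ge> G + 1 + 2 * P"
  shows "(y - c)\<^sup>2 - e \<ge> (y - G)\<^sup>2 / 2"
proof -
  have "(y - G)\<^sup>2 \<ge> (1 + 2 * P)\<^sup>2" using assms by (intro power_mono) auto
  moreover have "(1 + 2 * P)\<^sup>2 \<ge> 2 * P" using assms by (simp add: power2_eq_square algebra_simps)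
  moreover have "(y - c)\<^sup>2 \<ge> (y - G)\<^sup>2" using assms by (intro power_mono) auto
  ultimately show ?thesis using assms by linarith
qed

text \<open>A solution that is ever large must have blown up in finite time in the past.\<close>

lemma riccati_global_upper_bound:
  assumes x: "ode_solution (riccati \<gamma> p) UNIV x"
    and "\<And>t. \<bar>\<gamma> t\<bar> \<le> G" "\<And>t. \<bar>p t\<bar> \<le> P"
  shows "x t < G + 1 + 2 * P"
proof -
  have "P \<ge> 0" using assms(3)[of 0] by linarith
  have "(\<lambda>u. x (- u)) (- t) < G + 1 + 2 * P"
  proof (rule quadratic_growth_bound[where f = "\<lambda>u. x (- u)" and ?t0.0 = "- t" and m = G and f' = "\<lambda>u. - riccati \<gamma> p (- u) (x (- u))"])
    show "((\<lambda>u. x (- u)) has_real_derivative - riccati \<gamma> p (- u) (x (- u))) (at u)" for u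
      using ode_solutionD[OF x, of "- u"] by (simp add: DERIV_mirror)
    show "(x (- u) - G)\<^sup>2 / 2 \<le> - riccati \<gamma> p (- u) (x (- u))" if "G + 1 + 2 * P \<le> x (- u)" for u
      using riccati_rate[OF assms(2)[of "- u"] assms(3)[of "- u"] that] by (simp add: riccati_def)
  qed (use \<open>P \<ge> 0\<close> in simp)
  then show ?thesis by simp
qed

lemma riccati_global_bounded:
  assumes x: "ode_solution (riccati \<gamma> p) UNIV x"
    and "\<And>t. \<bar>\<gamma> t\<bar> \<le> G" "\<And>t. \<bar>p t\<bar> \<le> P"
  shows "\<bar>x t\<bar> \<le> G + 1 + 2 * P"
proof -
  have "ode_solution (riccati (reflect \<gamma>) (\<lambda>t. p (- t))) UNIV (reflect x)"
    using ode_solution_reflect[OF x] by (simp add: surj_uminus)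
  from riccati_global_upper_bound[OF this, of G P "- t"] assms(2,3)
    riccati_global_upper_bound[OF assms, of t]
  show ?thesis by (simp add: reflect_def)
qed

text \<open>Below the level \<open>- (G + 1 + 2 * P)\<close> solutions decrease. Once far below that level and below \<open>y0\<close>, a solution could not reach
  \<open>y0\<close> at the later time \<open>s\<close>.\<close>

lemma riccati_backward_lower_bound:
  assumes x: "ivp_solution (riccati \<gamma> p) s y0 J x" and t: "t \<in> J" "t \<le> s"
    and "\<And>t. \<bar>\<gamma> t\<bar> \<le> G" "\<And>t. \<bar>p t\<bar> \<le> P"
  shows "x t \<ge> min y0 (- (G + 1 + 2 * P)) - 1"
proof (rule ccontr)
  define l where "l = - (min y0 (- (G + 1 + 2 * P)) - 1)"
  assume "\<not> ?thesis"
  then have l: "- x t \<ge> l" "l > - y0" "l > G + 1 + 2 * P" by (auto simp: l_def)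
  note X = ivp_solutionD[OF x]
  have "- x s \<ge> l"
  proof (rule trapped_above[where f = "\<lambda>u. - x u" and ?t1.0 = t and f' = "\<lambda>u. - riccati \<gamma> p u (x u)"])
    show "((\<lambda>u. - x u) has_real_derivative - riccati \<gamma> p u (x u)) (at u)" if "t \<le> u" "u \<le> s" for u
    proof -
      have "u \<in> J" using X(2,3) t that unfolding is_interval_1 by blast
      then show ?thesis by (intro DERIV_minus ode_solutionD[OF X(4)])
    qed
    show "- riccati \<gamma> p u (x u) > 0" if "- x u = l" for u
    proof -
      have "(l - G)\<^sup>2 / 2 \<le> (l + \<gamma> u)\<^sup>2 - p u"
        using riccati_rate[of "- \<gamma> u" G "p u" P l] assms(4)[of u] assms(5)[of u] l by simp
      moreover have "P \<ge> 0" using assms(5)[of 0] by linarith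
      then have "(l - G)\<^sup>2 > 0" using l by simp
      moreover have "(x u - \<gamma> u)\<^sup>2 = (l + \<gamma> u)\<^sup>2"
        unfolding that[symmetric] by (simp add: power2_eq_square algebra_simps)
      ultimately show ?thesis unfolding riccati_def by linarith
    qed
  qed (use l t in auto)
  then show False using X(5) l by simp
qed

section \<open>Pullback attraction at an exponential rate\<close>

text \<open>Stated through local solutions instead of the maximal one, which makes the criterion easy to
  transfer along the symmetries of the equation.\<close>

lemma locally_pullback_attractive_if_exponential:
  assumes u: "unique_solutions h" and a: "ode_solution h UNIV a" and "\<delta> > 0" "\<kappa> > 0"
    and near: "\<And>s y0. s \<le> s0 \<Longrightarrow> \<bar>y0 - a s\<bar> \<le> \<delta> \<Longrightarrow>
      \<exists>J x. ivp_solution h s y0 J x \<and> {s..s0} \<subseteq> J \<and>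
        (\<forall>t\<in>{s..s0}. \<bar>a t - x t\<bar> \<le> K * exp (- \<kappa> * (t - s)))"
  shows "locally_pullback_attractive h \<infinity> a"
proof -
  have max: "{s..s0} \<subseteq> max_interval h s y0 \<and>
      (\<forall>t\<in>{s..s0}. \<bar>a t - max_sol h t s y0\<bar> \<le> K * exp (- \<kappa> * (t - s)))"
    if s: "s \<le> s0" and y0: "\<bar>y0 - a s\<bar> \<le> \<delta>" for s y0
  proof -
    obtain J x where J: "ivp_solution h s y0 J x" "{s..s0} \<subseteq> J"
      "\<forall>t\<in>{s..s0}. \<bar>a t - x t\<bar> \<le> K * exp (- \<kappa> * (t - s))"
      using near[OF s y0] by blast
    show ?thesis
      using J max_intervalI[OF J(1)] max_sol_eq[OF u J(1)] by (auto simp: subset_iff)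
  qed
  have lim: "((\<lambda>s. SUP y0\<in>{a s - \<delta>..a s + \<delta>}. \<bar>a t - max_sol h t s y0\<bar>) \<longlongrightarrow> 0) at_bot"
    if t: "t \<le> s0" for t
  proof (rule tendsto_sandwich[OF _ _ tendsto_const])
    have bnd: "\<bar>a t - max_sol h t s y0\<bar> \<le> K * exp (- \<kappa> * (t - s))"
      if "s \<le> t" "y0 \<in> {a s - \<delta>..a s + \<delta>}" for s y0
      using max[of s y0] that t by (auto simp: abs_le_iff)
    show "\<forall>\<^sub>F s in at_bot. 0 \<le> (SUP y0\<in>{a s - \<delta>..a s + \<delta>}. \<bar>a t - max_sol h t s y0\<bar>)"
      using eventually_le_at_bot[of t]
    proof eventually_elim
      case (elim s)
      have "bdd_above ((\<lambda>y0. \<bar>a t - max_sol h t s y0\<bar>) ` {a s - \<delta>..a s + \<delta>})"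
        by (rule bdd_aboveI2) (rule bnd[OF elim])
      then show ?case by (rule cSUP_upper2[of _ _ "a s"]) (use \<open>\<delta> > 0\<close> in auto)
    qed
    show "\<forall>\<^sub>F s in at_bot. (SUP y0\<in>{a s - \<delta>..a s + \<delta>}. \<bar>a t - max_sol h t s y0\<bar>)
        \<le> K * exp (- \<kappa> * (t - s))"
      using eventually_le_at_bot[of t]
    proof eventually_elim
      case (elim s)
      show ?case by (rule cSUP_least) (use bnd[OF elim] \<open>\<delta> > 0\<close> in auto)
    qed
    show "((\<lambda>s. K * exp (- \<kappa> * (t - s))) \<longlongrightarrow> 0) at_bot"
      by (rule exponential_decay_at_bot[OF \<open>\<kappa> > 0\<close>])
  qed
  show ?thesis
    unfolding locally_pullback_attractive_def
    using a max lim \<open>\<delta> > 0\<close> by (intro conjI exI[of _ s0] exI[of _ \<delta>]) auto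
qed

section \<open>Transition between two limit equations with a unique bounded solution\<close>

text \<open>Here \<open>\<gamma>\<close> is any bounded transition from \<open>-1\<close> to \<open>1\<close> with derivative \<open>g\<close> vanishing at both ends,
  and \<open>a\<close>, \<open>r\<close> are uniformly separated solutions of the untranslated equation. The assumptions are
  invariant under reflection (lemma \<open>reflected\<close>). For hyperbolic \<open>a\<close> and \<open>r\<close> the uniform
  separation is \<open>hyperbolic_gap\<close>. Uniqueness is stated among all solutions on the line, since these are bounded.\<close>

locale critical_transition =
  fixes \<gamma> g p a r b :: "real \<Rightarrow> real" and P \<delta> D :: real
  assumes \<gamma>_deriv: "\<And>t. (\<gamma> has_real_derivative g t) (at t)"
    and \<gamma>_bound: "\<And>t. \<bar>\<gamma> t\<bar> \<le> 1"
    and \<gamma>_at_bot: "(\<gamma> \<longlongrightarrow> -1) at_bot" and \<gamma>_at_top: "(\<gamma> \<longlongrightarrow> 1) at_top"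
    and g_at_bot: "(g \<longlongrightarrow> 0) at_bot" and g_at_top: "(g \<longlongrightarrow> 0) at_top"
    and p_bound: "\<And>t. \<bar>p t\<bar> \<le> P"
    and a: "ode_solution (riccati (\<lambda>_. 0) p) UNIV a"
    and r: "ode_solution (riccati (\<lambda>_. 0) p) UNIV r"
    and gap_pos: "\<delta> > 0" and gap: "\<And>t. a t - r t \<ge> \<delta>" "\<And>t. a t - r t \<le> D"
    and b: "ode_solution (riccati \<gamma> p) UNIV b"
    and b_unique: "\<And>x. ode_solution (riccati \<gamma> p) UNIV x \<Longrightarrow> x = b"
begin

abbreviation h :: "real \<Rightarrow> real \<Rightarrow> real" where "h \<equiv> riccati \<gamma> p"

lemma reflected:
  "critical_transition (reflect \<gamma>) (\<lambda>t. g (- t)) (\<lambda>t. p (- t)) (reflect r) (reflect a) (reflect b) P \<delta> D"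
proof
  have refl0: "reflect (\<lambda>_. 0) = (\<lambda>_. 0)" by (simp add: reflect_def fun_eq_iff)
  show "(reflect \<gamma> has_real_derivative g (- t)) (at t)" for t
    by (rule DERIV_reflect[OF \<gamma>_deriv])
  show "\<bar>reflect \<gamma> t\<bar> \<le> 1" "\<bar>p (- t)\<bar> \<le> P" for t
    using \<gamma>_bound[of "- t"] p_bound by (auto simp: reflect_def)
  show "(reflect \<gamma> \<longlongrightarrow> -1) at_bot" "(reflect \<gamma> \<longlongrightarrow> 1) at_top"
    using tendsto_minus[OF filterlim_compose[OF \<gamma>_at_top filterlim_uminus_at_top_at_bot]]
      tendsto_minus[OF filterlim_compose[OF \<gamma>_at_bot filterlim_uminus_at_bot_at_top]]
    by (simp_all add: reflect_def[abs_def])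
  show "((\<lambda>t. g (- t)) \<longlongrightarrow> 0) at_bot" "((\<lambda>t. g (- t)) \<longlongrightarrow> 0) at_top"
    by (rule filterlim_compose[OF g_at_top filterlim_uminus_at_top_at_bot]
        filterlim_compose[OF g_at_bot filterlim_uminus_at_bot_at_top])+
  show "ode_solution (riccati (\<lambda>_. 0) (\<lambda>t. p (- t))) UNIV (reflect r)"
    "ode_solution (riccati (\<lambda>_. 0) (\<lambda>t. p (- t))) UNIV (reflect a)"
    using ode_solution_reflect[OF a] ode_solution_reflect[OF r] by (simp_all add: refl0 surj_uminus)
  show "\<delta> > 0" by (rule gap_pos)
  show "reflect r t - reflect a t \<ge> \<delta>" "reflect r t - reflect a t \<le> D" for t
    using gap[of "- t"] by (simp_all add: reflect_def)
  show "ode_solution (riccati (reflect \<gamma>) (\<lambda>t. p (- t))) UNIV (reflect b)"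
    using ode_solution_reflect[OF b] by (simp add: surj_uminus)
  show "x = reflect b" if "ode_solution (riccati (reflect \<gamma>) (\<lambda>t. p (- t))) UNIV x" for x
    using b_unique[of "reflect x"] ode_solution_reflect[OF that] by (simp add: surj_uminus) (metis reflect_reflect)
qed

lemma \<gamma>_continuous: "continuous_on UNIV \<gamma>"
  by (meson DERIV_isCont \<gamma>_deriv continuous_at_imp_continuous_on)

lemmas h_unique = riccati_unique[OF \<gamma>_continuous, of p]

text \<open>The coordinate in which \<open>\<gamma> + r\<close> is \<open>0\<close> and \<open>\<gamma> + a\<close> is \<open>1\<close>.\<close>

definition \<phi> :: "(real \<Rightarrow> real) \<Rightarrow> real \<Rightarrow> real" where
  "\<phi> x t = (x t - \<gamma> t - r t) / (a t - r t)"

lemma gap_nonzero: "a t - r t > 0"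
  using gap(1)[of t] gap_pos by simp

lemma \<phi>_eq: "x t = \<gamma> t + r t + (a t - r t) * \<phi> x t"
  using gap_nonzero[of t] by (simp add: \<phi>_def)

lemma gap_deriv: "((\<lambda>t. a t - r t) has_real_derivative - (a t + r t) * (a t - r t)) (at t)"
  using ode_solutionD[OF a, of t] ode_solutionD[OF r, of t]
  by (auto intro!: derivative_eq_intros simp: riccati_def power2_eq_square algebra_simps)

text \<open>With \<open>d = a - r\<close> and \<open>N = x - \<gamma> - r\<close> one has \<open>N' = - (N + 2 * r) * N - g\<close> and \<open>d' = - (a + r) * d\<close>, so the
  terms in \<open>r\<close> cancel in the quotient \<open>N / d\<close>.\<close>

lemma \<phi>_logistic:
  assumes "(x has_real_derivative h t (x t)) (at t)"
  shows "(\<phi> x has_real_derivative (a t - r t) * \<phi> x t * (1 - \<phi> x t) - g t / (a t - r t)) (at t)"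
proof -
  define d where "d = a t - r t"
  define N where "N = x t - \<gamma> t - r t"
  have d: "d > 0" using gap_nonzero by (simp add: d_def)
  have x: "x t = N + \<gamma> t + r t" and at: "a t = d + r t" by (simp_all add: N_def d_def)
  have "((\<lambda>t. x t - \<gamma> t - r t) has_real_derivative - (N + 2 * r t) * N - g t) (at t)"
    using assms ode_solutionD[OF r, of t] \<gamma>_deriv[of t]
    by (auto intro!: derivative_eq_intros simp: riccati_def N_def power2_eq_square algebra_simps)
  from DERIV_divide[OF this gap_deriv]
  have "((\<lambda>t. (x t - \<gamma> t - r t) / (a t - r t)) has_real_derivative
      ((- (N + 2 * r t) * N - g t) * d - N * (- (a t + r t) * d)) / (d * d)) (at t)"
    using d by (simp add: N_def d_def)
  also have "((- (N + 2 * r t) * N - g t) * d - N * (- (a t + r t) * d)) / (d * d)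
      = d * (N / d) * (1 - N / d) - g t / d"
    unfolding at using d by (simp add: field_simps)
  finally show ?thesis by (simp add: \<phi>_def[abs_def] N_def d_def)
qed

lemma perturbation_at_top: "((\<lambda>t. g t / (a t - r t)) \<longlongrightarrow> 0) at_top"
proof (rule tendsto_rabs_zero_cancel, rule tendsto_sandwich[OF _ _ tendsto_const])
  show "\<forall>\<^sub>F t in at_top. 0 \<le> \<bar>g t / (a t - r t)\<bar>" by simp
  show "\<forall>\<^sub>F t in at_top. \<bar>g t / (a t - r t)\<bar> \<le> \<bar>g t\<bar> / \<delta>"
  proof (intro always_eventually allI)
    fix t
    have "\<delta> \<le> \<bar>a t - r t\<bar>" using gap(1)[of t] by linarith
    then show "\<bar>g t / (a t - r t)\<bar> \<le> \<bar>g t\<bar> / \<delta>"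
      unfolding abs_divide using gap_pos by (intro frac_le) auto
  qed
  show "((\<lambda>t. \<bar>g t\<bar> / \<delta>) \<longlongrightarrow> 0) at_top"
    using tendsto_divide[OF tendsto_rabs_zero[OF g_at_top] tendsto_const[of \<delta>]] gap_pos by simp
qed

lemma forward_dichotomy:
  assumes "\<And>t. t \<ge> s \<Longrightarrow> (x has_real_derivative h t (x t)) (at t)"
    and "\<And>t. t \<ge> s \<Longrightarrow> \<phi> x t \<ge> L"
  shows "(\<phi> x \<longlongrightarrow> 0) at_top \<or> (\<phi> x \<longlongrightarrow> 1) at_top"
  by (rule perturbed_logistic_dichotomy[OF \<phi>_logistic[OF assms(1)] gap(1) gap_pos perturbation_at_top])
    (use assms(2) in auto)

lemma b_bound: "\<bar>b t\<bar> \<le> 1 + 1 + 2 * P"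
  by (rule riccati_global_bounded[OF b \<gamma>_bound p_bound])

lemma \<phi>_b_bounded: "\<exists>L. \<forall>t. \<bar>\<phi> b t\<bar> \<le> L"
proof (intro exI allI)
  fix t
  have "\<bar>r t\<bar> \<le> 0 + 1 + 2 * P" by (rule riccati_global_bounded[OF r _ p_bound]) simp
  then have "\<bar>b t - \<gamma> t - r t\<bar> \<le> 4 + 4 * P" using b_bound[of t] \<gamma>_bound[of t] by linarith
  then show "\<bar>\<phi> b t\<bar> \<le> (4 + 4 * P) / \<delta>"
    unfolding \<phi>_def abs_divide using gap(1)[of t] gap_pos by (intro frac_le) auto
qed

lemma \<phi>_reflect:
  "critical_transition.\<phi> (reflect \<gamma>) (reflect r) (reflect a) (reflect x) t = 1 - \<phi> x (- t)"
proof -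
  interpret R: critical_transition "reflect \<gamma>" "\<lambda>t. g (- t)" "\<lambda>t. p (- t)" "reflect r" "reflect a" "reflect b" P \<delta> D
    by (rule reflected)
  show ?thesis
    using gap_nonzero[of "- t"] by (simp add: R.\<phi>_def \<phi>_def reflect_def field_simps)
qed

text \<open>Reflection replaces \<open>\<phi>\<close> by \<open>1 - \<phi>\<close>, which satisfies a logistic equation of the same form in reversed time.\<close>

lemma backward_dichotomy: "(\<phi> b \<longlongrightarrow> 0) at_bot \<or> (\<phi> b \<longlongrightarrow> 1) at_bot"
proof -
  interpret R: critical_transition "reflect \<gamma>" "\<lambda>t. g (- t)" "\<lambda>t. p (- t)" "reflect r" "reflect a" "reflect b" P \<delta> D
    by (rule reflected)
  obtain L where L: "\<And>t. \<bar>R.\<phi> (reflect b) t\<bar> \<le> L" using R.\<phi>_b_bounded by blast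
  have "(R.\<phi> (reflect b) \<longlongrightarrow> 0) at_top \<or> (R.\<phi> (reflect b) \<longlongrightarrow> 1) at_top"
  proof (rule R.forward_dichotomy)
    show "- L \<le> R.\<phi> (reflect b) t" for t using L[of t] by linarith
  qed (use ode_solutionD[OF R.b] in auto)
  then have "((\<lambda>t. 1 - \<phi> b (- t)) \<longlongrightarrow> 0) at_top \<or> ((\<lambda>t. 1 - \<phi> b (- t)) \<longlongrightarrow> 1) at_top"
    by (simp add: \<phi>_reflect[abs_def])
  moreover have "(\<phi> b \<longlongrightarrow> 1 - l) at_bot" if "((\<lambda>t. 1 - \<phi> b (- t)) \<longlongrightarrow> l) at_top" for l
    using tendsto_diff[OF tendsto_const[of 1] filterlim_compose[OF that filterlim_uminus_at_top_at_bot]]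
    by simp
  ultimately show ?thesis by fastforce
qed

text \<open>For the solution \<open>x = b + exp (- q) / H\<close> the function on the left is
  \<open>(a - r) / (x - b)\<close>, the reciprocal of the distance of \<open>x\<close> from \<open>b\<close> in the coordinate \<open>\<phi>\<close>. It is defined for all times,
  also where \<open>x\<close> is not, and satisfies a linear equation.\<close>

lemma reciprocal_deriv:
  assumes q: "(q has_real_derivative 2 * (b t - \<gamma> t)) (at t)"
    and H: "(H has_real_derivative exp (- q t)) (at t)"
  shows "((\<lambda>t. (a t - r t) * H t * exp (q t)) has_real_derivative
    (a t - r t) * ((2 * \<phi> b t - 1) * ((a t - r t) * H t * exp (q t)) + 1)) (at t)"
proof -
  define d where "d = a t - r t"
  have "((\<lambda>t. (a t - r t) * H t * exp (q t)) has_real_derivative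
    (- (a t + r t) * d * H t + d * exp (- q t)) * exp (q t)
       + d * H t * (exp (q t) * (2 * (b t - \<gamma> t)))) (at t)"
    unfolding d_def
    using DERIV_mult[OF DERIV_mult[OF gap_deriv H] DERIV_chain'[OF q DERIV_exp]]
    by (rule DERIV_cong) (simp add: algebra_simps)
  moreover have "b t - \<gamma> t = r t + d * \<phi> b t" using \<phi>_eq[of b t] by (simp add: d_def)
  moreover have "a t = d + r t" by (simp add: d_def)
  moreover have "exp (- q t) * exp (q t) = 1" by (simp add: exp_minus)
  ultimately have "((\<lambda>t. (a t - r t) * H t * exp (q t)) has_real_derivative
    (- (d + r t + r t) * d * H t) * exp (q t) + d * 1
       + d * H t * (exp (q t) * (2 * (r t + d * \<phi> b t)))) (at t)"
    by (simp add: distrib_right mult.assoc)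
  then show ?thesis by (simp add: d_def[symmetric] algebra_simps)
qed

text \<open>If the limit were \<open>0\<close>, then \<open>2 * \<phi> b - 1 < 0\<close> in the far past, and the reciprocal distance
  \<open>\<Omega>\<close>, which satisfies \<open>\<Omega>' = (a - r) * ((2 * \<phi> b - 1) * \<Omega> + 1)\<close>, could not fall below \<open>4\<close> in backward time.
  Then \<open>H\<close> has no zero and yields a second solution on the line.\<close>

lemma \<phi>_b_at_bot: "(\<phi> b \<longlongrightarrow> 1) at_bot"
proof (rule ccontr)
  assume "\<not> (\<phi> b \<longlongrightarrow> 1) at_bot"
  with backward_dichotomy have "(\<phi> b \<longlongrightarrow> 0) at_bot" by blast
  then have "\<forall>\<^sub>F t in at_bot. \<phi> b t < 1 / 8" by (rule order_tendstoD) simp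
  then obtain T where T: "\<And>t. t \<le> T \<Longrightarrow> \<phi> b t < 1 / 8" unfolding eventually_at_bot_linorder by blast
  obtain q where q: "\<And>t. (q has_real_derivative 2 * (b t - \<gamma> t)) (at t)"
    using riccati_exponent[OF b \<gamma>_continuous] by blast
  obtain H where H: "\<And>t. (H has_real_derivative exp (- q t)) (at t)"
    and HT: "H T = 4 * exp (- q T) / (a T - r T)"
    using exp_primitive[OF q] by blast
  define \<Omega> where "\<Omega> t = (a t - r t) * H t * exp (q t)" for t
  have \<Omega>: "(\<Omega> has_real_derivative (a t - r t) * ((2 * \<phi> b t - 1) * \<Omega> t + 1)) (at t)" for t
    using reciprocal_deriv[OF q H] by (simp add: \<Omega>_def[abs_def])
  have \<Omega>T: "\<Omega> T = 4" using gap_nonzero[of T] by (simp add: \<Omega>_def HT exp_minus)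
  have left: "\<Omega> t \<ge> 4" if t: "t \<le> T" for t
  proof -
    have "\<Omega> (- (- t)) \<ge> 4"
    proof (rule trapped_above[where f = "\<lambda>u. \<Omega> (- u)" and ?t1.0 = "- T"
          and f' = "\<lambda>u. - ((a (- u) - r (- u)) * ((2 * \<phi> b (- u) - 1) * \<Omega> (- u) + 1))"])
      show "((\<lambda>u. \<Omega> (- u)) has_real_derivative
          - ((a (- u) - r (- u)) * ((2 * \<phi> b (- u) - 1) * \<Omega> (- u) + 1))) (at u)" for u
        using \<Omega>[of "- u"] by (simp add: DERIV_mirror)
      show "- ((a (- u) - r (- u)) * ((2 * \<phi> b (- u) - 1) * \<Omega> (- u) + 1)) > 0"
        if "- T \<le> u" "\<Omega> (- u) = 4" for u
      proof -
        have "(2 * \<phi> b (- u) - 1) * \<Omega> (- u) + 1 < 0" using T[of "- u"] that by simp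
        then show ?thesis using gap_nonzero[of "- u"] by (simp add: mult_pos_neg)
      qed
    qed (use \<Omega>T t in auto)
    then show ?thesis by simp
  qed
  have pos: "H t > 0" for t
  proof -
    have "H t > 0" if "t \<le> T" for t
    proof -
      have "(a t - r t) * (H t * exp (q t)) > 0" using left[OF that] by (simp add: \<Omega>_def mult.assoc)
      then show ?thesis using gap_nonzero[of t] by (simp add: zero_less_mult_iff)
    qed
    then show ?thesis using exp_primitive_mono[OF H, of T t] by (cases "t \<le> T") (auto intro: less_le_trans)
  qed
  have "(\<lambda>t. b t + exp (- q t) / H t) = b"
    by (rule b_unique[OF riccati_family_solution[OF b q H]]) (metis less_irrefl pos)
  from fun_cong[OF this, of T] pos[of T] show False by simp
qed

lemma \<phi>_b_at_top: "(\<phi> b \<longlongrightarrow> 0) at_top"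
proof -
  interpret R: critical_transition "reflect \<gamma>" "\<lambda>t. g (- t)" "\<lambda>t. p (- t)" "reflect r" "reflect a" "reflect b" P \<delta> D
    by (rule reflected)
  have "((\<lambda>t. 1 - \<phi> b (- t)) \<longlongrightarrow> 1) at_bot"
    using R.\<phi>_b_at_bot by (simp add: \<phi>_reflect[abs_def])
  from tendsto_diff[OF tendsto_const[of 1] filterlim_compose[OF this filterlim_uminus_at_bot_at_top]]
  show ?thesis by simp
qed

lemma \<phi>_limit:
  assumes x: "(\<phi> x \<longlongrightarrow> 1) F" and \<gamma>: "(\<gamma> \<longlongrightarrow> c) F"
  shows "((\<lambda>t. \<bar>(a t + c) - x t\<bar>) \<longlongrightarrow> 0) F"
proof (rule tendsto_sandwich[OF _ _ tendsto_const])
  have eq: "(a t + c) - x t = (c - \<gamma> t) + (a t - r t) * (1 - \<phi> x t)" for t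
    using \<phi>_eq[of x t] by (simp add: algebra_simps)
  show "\<forall>\<^sub>F t in F. \<bar>(a t + c) - x t\<bar> \<le> \<bar>c - \<gamma> t\<bar> + D * \<bar>1 - \<phi> x t\<bar>"
  proof (intro always_eventually allI)
    fix t
    have "\<bar>(a t - r t) * (1 - \<phi> x t)\<bar> \<le> D * \<bar>1 - \<phi> x t\<bar>"
      using gap(2)[of t] gap_nonzero[of t] by (simp add: abs_mult mult_right_mono)
    then show "\<bar>(a t + c) - x t\<bar> \<le> \<bar>c - \<gamma> t\<bar> + D * \<bar>1 - \<phi> x t\<bar>"
      unfolding eq by linarith
  qed
  have "((\<lambda>t. \<bar>c - \<gamma> t\<bar> + D * \<bar>1 - \<phi> x t\<bar>) \<longlongrightarrow> \<bar>c - c\<bar> + D * \<bar>1 - 1\<bar>) F"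
    by (intro tendsto_intros x \<gamma>)
  then show "((\<lambda>t. \<bar>c - \<gamma> t\<bar> + D * \<bar>1 - \<phi> x t\<bar>) \<longlongrightarrow> 0) F" by simp
qed simp

lemma b_at_bot: "((\<lambda>t. \<bar>(a t - 1) - b t\<bar>) \<longlongrightarrow> 0) at_bot"
  using \<phi>_limit[OF \<phi>_b_at_bot \<gamma>_at_bot] by simp

text \<open>Since \<open>H\<close> increases, it stays positive to the right of \<open>s\<close>. To the left it must vanish somewhere, as otherwise the solution
  would be a second one on the line; at the zero of \<open>H\<close> the solution tends to \<open>+ \<infinity>\<close>.\<close>

lemma above_forward:
  assumes "y0 > b s"
  obtains J x where "ivp_solution h s y0 J x" "{s..} \<subseteq> J" "\<And>t. t \<in> J \<Longrightarrow> x t > b t"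
    "\<And>B. \<exists>t\<in>J. t \<le> s \<and> x t > B"
proof -
  obtain q where q: "\<And>t. (q has_real_derivative 2 * (b t - \<gamma> t)) (at t)"
    using riccati_exponent[OF b \<gamma>_continuous] by blast
  obtain H where H: "\<And>t. (H has_real_derivative exp (- q t)) (at t)"
    and Hs: "H s = exp (- q s) / (y0 - b s)"
    using exp_primitive[OF q] by blast
  have Hs_pos: "H s > 0" using assms by (simp add: Hs)
  have cont: "continuous_on UNIV H" by (meson DERIV_isCont H continuous_at_imp_continuous_on)
  define J where "J = {t. H t > 0}"
  define x where "x t = b t + exp (- q t) / H t" for t
  have sol: "ivp_solution h s y0 J x"
    unfolding ivp_solution_def
  proof (intro conjI)
    show "open J" unfolding J_def by (intro open_Collect_less cont continuous_intros)
    show "is_interval J"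
      unfolding is_interval_1 J_def using exp_primitive_mono[OF H] by (auto intro: less_le_trans)
    show "s \<in> J" using Hs_pos by (simp add: J_def)
    show "ode_solution h J x"
      unfolding x_def[abs_def] by (rule riccati_family_solution[OF b q H]) (simp add: J_def)
    show "x s = y0" using assms by (simp add: x_def Hs)
  qed
  moreover have "{s..} \<subseteq> J" using exp_primitive_mono[OF H, of s] Hs_pos by (auto simp: J_def intro: less_le_trans)
  moreover have "x t > b t" if "t \<in> J" for t using that by (simp add: J_def x_def)
  moreover have "\<exists>t\<in>J. t \<le> s \<and> x t > B" for B
  proof (rule ccontr)
    assume no: "\<not> (\<exists>t\<in>J. t \<le> s \<and> x t > B)"
    have "\<exists>u. H u \<le> 0"
    proof (rule ccontr)
      assume "\<nexists>u. H u \<le> 0"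
      then have "J = UNIV" by (auto simp: J_def not_le)
      then have "x = b" using b_unique[of x] ivp_solutionD(4)[OF sol] by simp
      then show False using ivp_solutionD(5)[OF sol] assms by simp
    qed
    then obtain u where u: "H u \<le> 0" by blast
    have "u \<le> s" using exp_primitive_mono[OF H, of s u] u Hs_pos by linarith
    then obtain z where z: "H z = 0" "z \<le> s"
      using IVT'[of H u 0 s] u Hs_pos continuous_on_subset[OF cont] by auto
    have zs: "z < s" using z Hs_pos by (cases "z = s") auto
    \<comment> \<open>the bound \<open>x t \<le> B\<close> means \<open>f t \<le> 0\<close> where \<open>H\<close> is positive, whereas \<open>f z > 0\<close> at the zero \<open>z\<close> of \<open>H\<close>\<close>
    define f where "f t = exp (- q t) - (B - b t) * H t" for t
    have "isCont f z"
      unfolding f_def using DERIV_isCont[OF q, of z] DERIV_isCont[OF H, of z]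
        DERIV_isCont[OF ode_solutionD[OF b], of z] by (intro continuous_intros) auto
    then have "(f \<longlongrightarrow> f z) (at_right z)"
      by (simp add: isCont_def filterlim_at_split)
    moreover have "f z > 0" by (simp add: f_def z)
    ultimately have "\<forall>\<^sub>F t in at_right z. f t > 0" by (rule order_tendstoD)
    moreover have "\<forall>\<^sub>F t in at_right z. t < s" by (rule eventually_at_rightI[of z s]) (use zs in auto)
    moreover have "\<forall>\<^sub>F t in at_right z. z < t" by (rule eventually_at_right_less)
    ultimately have "\<forall>\<^sub>F t in at_right z. f t > 0 \<and> t < s \<and> z < t" by eventually_elim simp
    then obtain t where t: "f t > 0" "t < s" "z < t"
      using eventually_happens[of _ "at_right z"] trivial_limit_at_right_real by blast
    have Ht: "H t > 0" using exp_primitive_strict_mono[OF H t(3)] z by simp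
    then have "t \<in> J" by (simp add: J_def)
    then have "x t \<le> B" using no t(2) by (meson less_imp_le not_le)
    then have "exp (- q t) \<le> (B - b t) * H t" using Ht by (simp add: x_def field_simps)
    then show False using t by (simp add: f_def)
  qed
  ultimately show ?thesis using that by blast
qed

lemma below_backward:
  assumes "y0 < b s"
  obtains J x where "ivp_solution h s y0 J x" "{..s} \<subseteq> J" "\<And>t. t \<in> J \<Longrightarrow> x t < b t"
    "\<And>B. \<exists>t\<in>J. t \<ge> s \<and> x t < B"
proof -
  interpret R: critical_transition "reflect \<gamma>" "\<lambda>t. g (- t)" "\<lambda>t. p (- t)" "reflect r" "reflect a" "reflect b" P \<delta> D
    by (rule reflected)
  have "- y0 > reflect b (- s)" using assms by (simp add: reflect_def)
  then obtain J x where J: "ivp_solution R.h (- s) (- y0) J x" "{- s..} \<subseteq> J"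
    "\<And>t. t \<in> J \<Longrightarrow> x t > reflect b t" "\<And>B. \<exists>t\<in>J. t \<le> - s \<and> x t > B"
    using R.above_forward by blast
  show ?thesis
  proof (rule that)
    show "ivp_solution h s y0 (uminus ` J) (reflect x)"
      using ivp_solution_reflect[OF J(1)] by simp
    show "{..s} \<subseteq> uminus ` J"
    proof
      fix t assume "t \<in> {..s}"
      then have "- t \<in> J" using J(2) by auto
      then show "t \<in> uminus ` J" by (metis image_eqI minus_minus)
    qed
    show "reflect x t < b t" if "t \<in> uminus ` J" for t
      using that J(3) by (fastforce simp: reflect_def)
    show "\<exists>t\<in>uminus ` J. t \<ge> s \<and> reflect x t < B" for B
    proof -
      obtain t where "t \<in> J" "t \<le> - s" "x t > - B" using J(4) by blast
      then show ?thesis by (intro bexI[of _ "- t"]) (auto simp: reflect_def)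
    qed
  qed
qed

lemma through_b: "ivp_solution h s (b s) UNIV b"
  using b by (simp add: ivp_solution_def)

lemma left_values_above:
  assumes "y0 > b s"
  shows "\<not> bdd_above (left_values h s y0)"
proof
  assume "bdd_above (left_values h s y0)"
  then obtain B where B: "\<And>y. y \<in> left_values h s y0 \<Longrightarrow> y \<le> B" unfolding bdd_above_def by blast
  obtain J x where J: "ivp_solution h s y0 J x" "\<And>B. \<exists>t\<in>J. t \<le> s \<and> x t > B"
    using above_forward[OF assms] by metis
  obtain t where t: "t \<in> J" "t \<le> s" "x t > B" using J(2) by blast
  have "x t \<in> left_values h s y0"
    unfolding left_values_def
    by (rule image_eqI[of _ _ t]) (use t max_intervalI[OF J(1)] max_sol_eq[OF h_unique J(1)] in auto)
  then show False using B t by fastforce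
qed

lemma left_values_below:
  assumes "y0 \<le> b s"
  shows "bounded (left_values h s y0)"
proof -
  obtain J x where J: "ivp_solution h s y0 J x" "{..s} \<subseteq> J" "\<And>t. t \<in> J \<Longrightarrow> x t \<le> b t"
  proof (cases "y0 = b s")
    case True
    then show ?thesis using that[OF through_b[of s, folded True]] by simp
  next
    case False
    then have "y0 < b s" using assms by simp
    then show ?thesis using below_backward[of y0 s] that less_imp_le by metis
  qed
  have "left_values h s y0 \<subseteq> {min y0 (- (1 + 1 + 2 * P)) - 1..1 + 1 + 2 * P}"
  proof
    fix y assume "y \<in> left_values h s y0"
    then obtain t where t: "t \<le> s" "y = max_sol h t s y0" by (auto simp: left_values_def)
    then have "y = x t" "t \<in> J" using max_sol_eq[OF h_unique J(1)] J(2) by auto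
    moreover have "x t \<le> 1 + 1 + 2 * P" using J(3)[OF \<open>t \<in> J\<close>] b_bound[of t] by linarith
    moreover have "x t \<ge> min y0 (- (1 + 1 + 2 * P)) - 1"
      by (rule riccati_backward_lower_bound[OF J(1) \<open>t \<in> J\<close> t(1) \<gamma>_bound p_bound])
    ultimately show "y \<in> {min y0 (- (1 + 1 + 2 * P)) - 1..1 + 1 + 2 * P}" by simp
  qed
  then show ?thesis by (rule bounded_subset[OF bounded_closed_interval])
qed

lemma left_unbounded_iff: "y0 > b s \<longleftrightarrow> \<not> bounded (left_values h s y0)"
  using left_values_above[of s y0] left_values_below[of y0 s] bounded_imp_bdd_above
  by (meson not_le)

lemma left_bdd_above_iff: "bdd_above (left_values h s y0) \<longleftrightarrow> y0 \<le> b s"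
  using left_values_above[of s y0] left_values_below[of y0 s] bounded_imp_bdd_above
  by (meson not_le)

lemma greatest_left_bdd_above: "(GREATEST y0. bdd_above (left_values h s y0)) = b s"
  unfolding left_bdd_above_iff by (rule Greatest_equality) auto

text \<open>If \<open>\<phi> x\<close> tended to \<open>0\<close> like \<open>\<phi> b\<close>, then the difference \<open>\<phi> x - \<phi> b\<close>, whose derivative is
  \<open>(a - r) * (\<phi> x - \<phi> b) * (1 - \<phi> x - \<phi> b)\<close>, would be positive, eventually increasing and tend to \<open>0\<close>.\<close>

lemma above_converges:
  assumes x: "\<And>t. t \<ge> s \<Longrightarrow> (x has_real_derivative h t (x t)) (at t)"
    and above: "\<And>t. t \<ge> s \<Longrightarrow> x t > b t"
  shows "(\<phi> x \<longlongrightarrow> 1) at_top"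
proof (rule ccontr)
  assume n: "\<not> (\<phi> x \<longlongrightarrow> 1) at_top"
  have gt: "\<phi> x t > \<phi> b t" if "t \<ge> s" for t
    using above[OF that] gap_nonzero[of t] by (simp add: \<phi>_def divide_strict_right_mono)
  obtain L where L: "\<And>t. \<bar>\<phi> b t\<bar> \<le> L" using \<phi>_b_bounded by blast
  have "\<phi> x t \<ge> - L" if "t \<ge> s" for t using gt[OF that] L[of t] by linarith
  with forward_dichotomy[OF x] n have "(\<phi> x \<longlongrightarrow> 0) at_top" by blast
  then have "\<forall>\<^sub>F t in at_top. \<phi> x t < 1 / 4" by (rule order_tendstoD) simp
  moreover have "\<forall>\<^sub>F t in at_top. \<phi> b t < 1 / 4" using \<phi>_b_at_top by (rule order_tendstoD) simp
  ultimately have "\<forall>\<^sub>F t in at_top. \<phi> x t < 1 / 4 \<and> \<phi> b t < 1 / 4" by eventually_elim simp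
  then obtain N where N: "\<And>t. t \<ge> N \<Longrightarrow> \<phi> x t < 1 / 4 \<and> \<phi> b t < 1 / 4"
    unfolding eventually_at_top_linorder by blast
  define T where "T = max N s"
  have mono: "\<phi> x T - \<phi> b T \<le> \<phi> x t - \<phi> b t" if "T \<le> t" for t
  proof (rule nondecreasing_if_derivative_nonneg[OF that])
    fix u assume u: "T \<le> u"
    show "((\<lambda>t. \<phi> x t - \<phi> b t) has_real_derivative
        ((a u - r u) * \<phi> x u * (1 - \<phi> x u) - g u / (a u - r u)) -
        ((a u - r u) * \<phi> b u * (1 - \<phi> b u) - g u / (a u - r u))) (at u)"
      using u by (intro DERIV_diff \<phi>_logistic x ode_solutionD[OF b]) (auto simp: T_def)
    have "((a u - r u) * \<phi> x u * (1 - \<phi> x u) - g u / (a u - r u)) -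
        ((a u - r u) * \<phi> b u * (1 - \<phi> b u) - g u / (a u - r u)) =
        (a u - r u) * (\<phi> x u - \<phi> b u) * (1 - \<phi> x u - \<phi> b u)"
      by (simp add: algebra_simps)
    also have "\<dots> \<ge> 0" using gap_nonzero[of u] gt[of u] N[of u] u by (auto simp: T_def)
    finally show "0 \<le> ((a u - r u) * \<phi> x u * (1 - \<phi> x u) - g u / (a u - r u)) -
        ((a u - r u) * \<phi> b u * (1 - \<phi> b u) - g u / (a u - r u))" .
  qed
  have "\<phi> x T - \<phi> b T \<le> 0 - 0"
    by (rule tendsto_lowerbound[OF tendsto_diff[OF \<open>(\<phi> x \<longlongrightarrow> 0) at_top\<close> \<phi>_b_at_top]])
      (use mono in \<open>auto simp: eventually_at_top_linorder\<close>)
  then show False using gt[of T] by (simp add: T_def)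
qed

text \<open>For the converse direction, \<open>b\<close> itself approaches \<open>r + 1\<close>, which stays away from \<open>a + 1\<close>; and a
  solution below \<open>b\<close> that exists on the whole future would exist on the line, since it exists on the whole past.\<close>

lemma forward_attraction_iff:
  "y0 > b s \<longleftrightarrow> {s..} \<subseteq> max_interval h s y0 \<and>
     ((\<lambda>t. \<bar>(a t + 1) - max_sol h t s y0\<bar>) \<longlongrightarrow> 0) at_top" (is "_ \<longleftrightarrow> ?dom \<and> ?lim")
proof
  assume "y0 > b s"
  then obtain J x where J: "ivp_solution h s y0 J x" "{s..} \<subseteq> J" "\<And>t. t \<in> J \<Longrightarrow> x t > b t"
    using above_forward by metis
  have "(\<phi> x \<longlongrightarrow> 1) at_top"
    by (rule above_converges[of s]) (use J ode_solutionD[OF ivp_solutionD(4)[OF J(1)]] in auto)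
  then have "((\<lambda>t. \<bar>(a t + 1) - x t\<bar>) \<longlongrightarrow> 0) at_top" by (rule \<phi>_limit[OF _ \<gamma>_at_top])
  moreover have "\<forall>\<^sub>F t in at_top. \<bar>(a t + 1) - x t\<bar> = \<bar>(a t + 1) - max_sol h t s y0\<bar>"
    using eventually_ge_at_top[of s]
    by eventually_elim (use max_sol_eq[OF h_unique J(1)] J(2) in auto)
  ultimately have ?lim by (rule Lim_transform_eventually)
  moreover have ?dom using J max_intervalI[OF J(1)] by blast
  ultimately show "?dom \<and> ?lim" by blast
next
  assume *: "?dom \<and> ?lim"
  show "y0 > b s"
  proof (rule ccontr)
    assume "\<not> y0 > b s"
    then consider "y0 = b s" | "y0 < b s" by linarith
    then show False
    proof cases
      case 1
      have "((\<lambda>t. \<bar>(a t + 1) - b t\<bar>) \<longlongrightarrow> 0) at_top"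
        using * max_sol_eq[OF h_unique through_b[of s]] by (simp add: 1)
      then have "((\<lambda>t. (a t + 1) - b t) \<longlongrightarrow> 0) at_top" by (rule tendsto_rabs_zero_cancel)
      then have "((\<lambda>t. ((a t + 1) - b t) + (\<gamma> t - 1)) \<longlongrightarrow> 0 + (1 - 1)) at_top"
        by (intro tendsto_intros \<gamma>_at_top)
      moreover have "((a t + 1) - b t) + (\<gamma> t - 1) = (a t - r t) * (1 - \<phi> b t)" for t
        using \<phi>_eq[of b t] by (simp add: algebra_simps)
      ultimately have "((\<lambda>t. (a t - r t) * (1 - \<phi> b t)) \<longlongrightarrow> 0) at_top" by simp
      then have "\<forall>\<^sub>F t in at_top. (a t - r t) * (1 - \<phi> b t) < \<delta> / 2"
        by (rule order_tendstoD) (simp add: gap_pos)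
      moreover have "\<forall>\<^sub>F t in at_top. \<phi> b t < 1 / 2" using \<phi>_b_at_top by (rule order_tendstoD) simp
      ultimately have "\<forall>\<^sub>F t in at_top. (a t - r t) * (1 - \<phi> b t) < \<delta> / 2 \<and> \<phi> b t < 1 / 2"
        by eventually_elim simp
      then obtain t where t: "(a t - r t) * (1 - \<phi> b t) < \<delta> / 2" "\<phi> b t < 1 / 2"
        using eventually_happens[of _ "at_top :: real filter"] by auto
      have "\<delta> * (1 / 2) \<le> (a t - r t) * (1 - \<phi> b t)"
        using t gap(1)[of t] gap_pos gap_nonzero[of t] by (intro mult_mono) auto
      then show False using t by simp
    next
      case 2
      then obtain J x where J: "ivp_solution h s y0 J x" "{..s} \<subseteq> J" using below_backward by metis
      let ?y = "\<lambda>t. max_sol h t s y0"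
      have "t \<in> max_interval h s y0" for t
        using * J max_intervalI[OF J(1), of t] by (cases "t \<le> s") auto
      then have "max_interval h s y0 = UNIV" by blast
      then have y: "ivp_solution h s y0 UNIV ?y" using ivp_solution_max[OF h_unique, of s y0] by simp
      then have "?y = b" using b_unique ivp_solutionD(4) by blast
      then show False using ivp_solutionD(5)[OF y] 2 by (metis less_irrefl)
    qed
  qed
qed

lemma b_at_top: "((\<lambda>t. \<bar>(r t + 1) - b t\<bar>) \<longlongrightarrow> 0) at_top"
proof -
  interpret R: critical_transition "reflect \<gamma>" "\<lambda>t. g (- t)" "\<lambda>t. p (- t)" "reflect r" "reflect a" "reflect b" P \<delta> D
    by (rule reflected)
  have "\<bar>(reflect r (- t) - 1) - reflect b (- t)\<bar> = \<bar>(r t + 1) - b t\<bar>" for t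
    by (simp add: reflect_def)
  then show ?thesis using filterlim_compose[OF R.b_at_bot filterlim_uminus_at_bot_at_top] by simp
qed

lemma right_unbounded_iff: "y0 < b s \<longleftrightarrow> \<not> bounded (right_values h s y0)"
proof -
  interpret R: critical_transition "reflect \<gamma>" "\<lambda>t. g (- t)" "\<lambda>t. p (- t)" "reflect r" "reflect a" "reflect b" P \<delta> D
    by (rule reflected)
  show ?thesis
    using R.left_unbounded_iff[of "- s" "- y0"]
    by (simp add: right_values_reflect[OF \<gamma>_continuous] reflect_def)
qed

lemma right_bdd_below_iff: "bdd_below (right_values h s y0) \<longleftrightarrow> y0 \<ge> b s"
proof -
  interpret R: critical_transition "reflect \<gamma>" "\<lambda>t. g (- t)" "\<lambda>t. p (- t)" "reflect r" "reflect a" "reflect b" P \<delta> D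
    by (rule reflected)
  show ?thesis
    using R.left_bdd_above_iff[of "- s" "- y0"]
    by (simp add: right_values_reflect[OF \<gamma>_continuous] reflect_def)
qed

lemma least_right_bdd_below: "(LEAST y0. bdd_below (right_values h s y0)) = b s"
  unfolding right_bdd_below_iff by (rule Least_equality) auto

lemma backward_attraction_iff:
  "y0 < b s \<longleftrightarrow> {..s} \<subseteq> max_interval h s y0 \<and>
     ((\<lambda>t. \<bar>(r t - 1) - max_sol h t s y0\<bar>) \<longlongrightarrow> 0) at_bot"
proof -
  interpret R: critical_transition "reflect \<gamma>" "\<lambda>t. g (- t)" "\<lambda>t. p (- t)" "reflect r" "reflect a" "reflect b" P \<delta> D
    by (rule reflected)
  have dom: "{- s..} \<subseteq> uminus ` M \<longleftrightarrow> {..s} \<subseteq> M" for M :: "real set"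
  proof -
    have "{- s..} = uminus ` {..s}" by simp
    then show ?thesis by (simp only: inj_image_subset_iff[OF inj_uminus])
  qed
  have lim: "((\<lambda>t. \<bar>(reflect r t + 1) - max_sol R.h t (- s) (- y0)\<bar>) \<longlongrightarrow> 0) at_top \<longleftrightarrow>
      ((\<lambda>t. \<bar>(r t - 1) - max_sol h t s y0\<bar>) \<longlongrightarrow> 0) at_bot"
    if "{..s} \<subseteq> max_interval h s y0"
  proof -
    have eq: "\<bar>(reflect r (- t) + 1) - max_sol R.h (- t) (- s) (- y0)\<bar> = \<bar>(r t - 1) - max_sol h t s y0\<bar>"
      if "t \<le> s" for t
    proof -
      have "max_sol R.h (- t) (- s) (- y0) = - max_sol h t s y0"
        by (rule max_sol_reflect[OF \<gamma>_continuous]) (use that \<open>{..s} \<subseteq> _\<close> in auto)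
      then show ?thesis by (simp add: reflect_def)
    qed
    have "((\<lambda>t. \<bar>(reflect r t + 1) - max_sol R.h t (- s) (- y0)\<bar>) \<longlongrightarrow> 0) at_top \<longleftrightarrow>
        ((\<lambda>t. \<bar>(reflect r (- t) + 1) - max_sol R.h (- t) (- s) (- y0)\<bar>) \<longlongrightarrow> 0) at_bot"
      by (simp add: at_top_mirror filterlim_filtermap)
    also have "\<dots> \<longleftrightarrow> ((\<lambda>t. \<bar>(r t - 1) - max_sol h t s y0\<bar>) \<longlongrightarrow> 0) at_bot"
      by (rule tendsto_cong[OF eventually_mono[OF eventually_le_at_bot[of s] eq]])
    finally show ?thesis .
  qed
  show ?thesis
    using R.forward_attraction_iff[of "- s" "- y0"] lim
    by (auto simp: reflect_def[of b] max_interval_reflect dom)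
qed

text \<open>In the past \<open>\<phi> b\<close> is near \<open>1\<close>, so \<open>\<bar>\<Omega>\<bar> = (a - r) / \<bar>x - b\<bar>\<close> satisfies
  \<open>\<bar>\<Omega>\<bar>' \<ge> (a - r) * (\<bar>\<Omega>\<bar> / 2 - 1) \<ge> \<delta> / 4 * \<bar>\<Omega>\<bar>\<close> as long as \<open>\<bar>\<Omega>\<bar> \<ge> 4\<close>. It therefore grows exponentially once it is at
  least \<open>4\<close>, which holds if the initial distance is at most \<open>\<delta> / 4\<close>.\<close>

lemma exponentially_attracting:
  "\<exists>s0. \<forall>s\<le>s0. \<forall>y0. \<bar>y0 - b s\<bar> \<le> \<delta> / 4 \<longrightarrow>
      (\<exists>J x. ivp_solution h s y0 J x \<and> {s..s0} \<subseteq> J \<and>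
        (\<forall>t\<in>{s..s0}. \<bar>b t - x t\<bar> \<le> D / 4 * exp (- (\<delta> / 4) * (t - s))))"
proof -
  have "\<forall>\<^sub>F t in at_bot. \<phi> b t > 3 / 4" using \<phi>_b_at_bot by (rule order_tendstoD) simp
  then obtain s0 where s0: "\<And>t. t \<le> s0 \<Longrightarrow> \<phi> b t > 3 / 4" unfolding eventually_at_bot_linorder by blast
  have D: "D > 0" using gap_nonzero[of 0] gap(2)[of 0] by simp
  obtain q where q: "\<And>t. (q has_real_derivative 2 * (b t - \<gamma> t)) (at t)"
    using riccati_exponent[OF b \<gamma>_continuous] by blast
  show ?thesis
  proof (intro exI[of _ s0] allI impI)
    fix s y0 assume s: "s \<le> s0" and y0: "\<bar>y0 - b s\<bar> \<le> \<delta> / 4"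
    show "\<exists>J x. ivp_solution h s y0 J x \<and> {s..s0} \<subseteq> J \<and>
        (\<forall>t\<in>{s..s0}. \<bar>b t - x t\<bar> \<le> D / 4 * exp (- (\<delta> / 4) * (t - s)))"
    proof (cases "y0 = b s")
      case True
      then show ?thesis
        using through_b[of s] D by (intro exI[of _ UNIV] exI[of _ b]) auto
    next
      case False
      obtain H where H: "\<And>t. (H has_real_derivative exp (- q t)) (at t)"
        and Hs: "H s = exp (- q s) / (y0 - b s)"
        using exp_primitive[OF q] by blast
      \<comment> \<open>the sign of \<open>x - b\<close>, and of \<open>H\<close>, on \<open>{s..s0}\<close>; thus \<open>f\<close> is \<open>\<bar>\<Omega>\<bar>\<close> there\<close>
      define \<sigma> where "\<sigma> = sgn (y0 - b s)"
      have \<sigma>: "\<sigma> = 1 \<or> \<sigma> = -1" using False by (auto simp: \<sigma>_def sgn_if)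
      define f where "f t = \<sigma> * ((a t - r t) * H t * exp (q t))" for t
      define f' where "f' t = (a t - r t) * ((2 * \<phi> b t - 1) * f t + \<sigma>)" for t
      have f: "(f has_real_derivative f' t) (at t)" for t
      proof -
        have "\<sigma> * ((a t - r t) * ((2 * \<phi> b t - 1) * ((a t - r t) * H t * exp (q t)) + 1)) = f' t"
          by (simp add: f_def f'_def algebra_simps)
        then show ?thesis
          using DERIV_cmult[OF reciprocal_deriv[OF q H, of t], of \<sigma>] by (simp add: f_def[abs_def])
      qed
      have rate: "f' t \<ge> \<delta> / 4 * f t" if "t \<le> s0" "f t \<ge> 4" for t
      proof -
        have "1 / 2 * f t \<le> (2 * \<phi> b t - 1) * f t"
          using s0[OF that(1)] that(2) by (intro mult_right_mono) auto
        moreover have "\<sigma> \<ge> - 1" using \<sigma> by auto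
        ultimately have "f t / 4 \<le> (2 * \<phi> b t - 1) * f t + \<sigma>" using that by linarith
        then have "\<delta> * (f t / 4) \<le> f' t"
          unfolding f'_def using gap(1)[of t] gap_nonzero[of t] that(2) by (intro mult_mono) auto
        then show ?thesis by simp
      qed
      have fs: "f s \<ge> 4"
      proof -
        have "f s = (a s - r s) / \<bar>y0 - b s\<bar>"
          using False by (simp add: f_def Hs \<sigma>_def exp_minus sgn_if field_simps)
        moreover have "4 * \<bar>y0 - b s\<bar> \<le> a s - r s" using y0 gap(1)[of s] by simp
        moreover have "\<bar>y0 - b s\<bar> > 0" using False by simp
        ultimately show ?thesis by (simp add: pos_le_divide_eq)
      qed
      have trapped: "f t \<ge> 4" if "s \<le> t" "t \<le> s0" for t
      proof (rule trapped_above[OF f _ fs that(1)])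
        show "f' u > 0" if "s \<le> u" "u \<le> t" "f u = 4" for u
          using rate[of u] that \<open>t \<le> s0\<close> gap_pos by simp
      qed
      have growth: "f t \<ge> 4 * exp (\<delta> / 4 * (t - s))" if t: "s \<le> t" "t \<le> s0" for t
      proof -
        have "f s * exp (- (\<delta> / 4) * (s - s)) \<le> f t * exp (- (\<delta> / 4) * (t - s))"
        proof (rule nondecreasing_if_derivative_nonneg[OF t(1)])
          show "((\<lambda>t. f t * exp (- (\<delta> / 4) * (t - s))) has_real_derivative
              (f' u - \<delta> / 4 * f u) * exp (- (\<delta> / 4) * (u - s))) (at u)" for u
            using f[of u] by (auto intro!: derivative_eq_intros simp: algebra_simps)
          show "0 \<le> (f' u - \<delta> / 4 * f u) * exp (- (\<delta> / 4) * (u - s))" if "s \<le> u" "u \<le> t" for u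
            using rate[of u] trapped[of u] that t by simp
        qed
        then have "4 \<le> f t * exp (- (\<delta> / 4) * (t - s))" using fs by simp
        then have "4 * exp (\<delta> / 4 * (t - s)) \<le> f t * exp (- (\<delta> / 4) * (t - s)) * exp (\<delta> / 4 * (t - s))"
          by (rule mult_right_mono) simp
        also have "\<dots> = f t" by (simp add: mult.assoc flip: exp_add)
        finally show ?thesis .
      qed
      define J where "J = {t. \<sigma> * H t > 0}"
      define x where "x t = b t + exp (- q t) / H t" for t
      have cont: "continuous_on UNIV H" by (meson DERIV_isCont H continuous_at_imp_continuous_on)
      have sol: "ivp_solution h s y0 J x"
        unfolding ivp_solution_def
      proof (intro conjI)
        show "open J" unfolding J_def by (intro open_Collect_less cont continuous_intros)
        show "is_interval J"
          unfolding is_interval_1 J_def using \<sigma> exp_primitive_mono[OF H]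
          by (auto intro: less_le_trans le_less_trans)
        show "s \<in> J" using False by (auto simp: J_def Hs \<sigma>_def sgn_if divide_neg_neg zero_less_divide_iff)
        show "ode_solution h J x"
          unfolding x_def[abs_def] by (rule riccati_family_solution[OF b q H]) (auto simp: J_def)
        show "x s = y0" using False by (simp add: x_def Hs)
      qed
      moreover have inJ: "{s..s0} \<subseteq> J"
      proof
        fix t assume t: "t \<in> {s..s0}"
        have "(a t - r t) * exp (q t) * (\<sigma> * H t) > 0"
          using trapped[of t] t by (simp add: f_def mult_ac)
        moreover have "(a t - r t) * exp (q t) > 0" using gap_nonzero[of t] by simp
        ultimately show "t \<in> J" unfolding J_def using zero_less_mult_pos by blast
      qed
      moreover have "\<bar>b t - x t\<bar> \<le> D / 4 * exp (- (\<delta> / 4) * (t - s))" if t: "t \<in> {s..s0}" for t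
      proof -
        have ft: "f t = (a t - r t) * \<bar>H t\<bar> * exp (q t)"
          using \<sigma> inJ t by (auto simp: f_def J_def)
        have "f t > 0" using trapped[of t] t by simp
        have "\<bar>b t - x t\<bar> = exp (- q t) / \<bar>H t\<bar>" by (simp add: x_def abs_divide)
        also have "\<dots> = (a t - r t) / f t"
          unfolding ft mult.assoc using gap_nonzero[of t]
          by (simp add: exp_minus inverse_eq_divide mult.commute)
        also have "\<dots> \<le> D / (4 * exp (\<delta> / 4 * (t - s)))"
          using gap(2)[of t] D growth[of t] t by (intro frac_le) auto
        also have "\<dots> = D / 4 * exp (- (\<delta> / 4) * (t - s))"
          unfolding minus_mult_left[symmetric] exp_minus by (simp only: inverse_eq_divide times_divide_times_eq mult_1_right)
        finally show ?thesis .
      qed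
      ultimately show ?thesis by blast
    qed
  qed
qed

lemma pullback_attractive: "locally_pullback_attractive h \<infinity> b"
proof -
  obtain s0 where "\<forall>s\<le>s0. \<forall>y0. \<bar>y0 - b s\<bar> \<le> \<delta> / 4 \<longrightarrow>
      (\<exists>J x. ivp_solution h s y0 J x \<and> {s..s0} \<subseteq> J \<and>
        (\<forall>t\<in>{s..s0}. \<bar>b t - x t\<bar> \<le> D / 4 * exp (- (\<delta> / 4) * (t - s))))"
    using exponentially_attracting by blast
  then show ?thesis
    using gap_pos
    by (intro locally_pullback_attractive_if_exponential[OF h_unique b, of "\<delta> / 4" "\<delta> / 4" s0 "D / 4"]) auto

qed

text \<open>The time-reversed equation is obtained from the reflected one by a change of sign of the unknown.\<close>

lemma pullback_repulsive: "locally_pullback_repulsive h (-\<infinity>) b"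
proof -
  interpret R: critical_transition "reflect \<gamma>" "\<lambda>t. g (- t)" "\<lambda>t. p (- t)" "reflect r" "reflect a" "reflect b" P \<delta> D
    by (rule reflected)
  let ?k = "\<lambda>t y. - h (- t) y"
  have flip: "ivp_solution ?k s (- y0) J (\<lambda>t. - x t)" if "ivp_solution R.h s y0 J x" for s y0 J x
    unfolding ivp_solution_def ode_solution_def
    using ivp_solutionD[OF that] DERIV_minus[OF ode_solutionD[OF ivp_solutionD(4)[OF that]]]
    by (auto simp: riccati_def reflect_def power2_eq_square algebra_simps)
  have flip': "ivp_solution R.h s (- y0) J (\<lambda>t. - x t)" if "ivp_solution ?k s y0 J x" for s y0 J x
    unfolding ivp_solution_def ode_solution_def
    using ivp_solutionD[OF that] DERIV_minus[OF ode_solutionD[OF ivp_solutionD(4)[OF that]]]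
    by (auto simp: riccati_def reflect_def power2_eq_square algebra_simps)
  have unique: "unique_solutions ?k"
    unfolding unique_solutions_def
  proof (intro allI impI)
    fix s y0 J x J' x' t
    assume "ivp_solution ?k s y0 J x" "ivp_solution ?k s y0 J' x'" "t \<in> J" "t \<in> J'"
    then have "- x t = - x' t"
      using R.h_unique[unfolded unique_solutions_def, rule_format, OF flip' flip'] by blast
    then show "x t = x' t" by simp
  qed
  obtain s0 where s0: "\<forall>s\<le>s0. \<forall>y0. \<bar>y0 - reflect b s\<bar> \<le> \<delta> / 4 \<longrightarrow>
      (\<exists>J x. ivp_solution R.h s y0 J x \<and> {s..s0} \<subseteq> J \<and>
        (\<forall>t\<in>{s..s0}. \<bar>reflect b t - x t\<bar> \<le> D / 4 * exp (- (\<delta> / 4) * (t - s))))"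
    using R.exponentially_attracting by blast
  have "locally_pullback_attractive ?k \<infinity> (\<lambda>t. b (- t))"
  proof (rule locally_pullback_attractive_if_exponential[OF unique])
    show "ode_solution ?k UNIV (\<lambda>t. b (- t))"
      using ode_solutionD[OF b] DERIV_mirror[of b] by (auto simp: ode_solution_def)
    show "\<delta> / 4 > 0" "\<delta> / 4 > 0" using gap_pos by auto
    fix s y0 assume "s \<le> s0" "\<bar>y0 - b (- s)\<bar> \<le> \<delta> / 4"
    then have "\<bar>- y0 - reflect b s\<bar> \<le> \<delta> / 4" by (simp add: reflect_def abs_minus_commute)

    then obtain J x where J: "ivp_solution R.h s (- y0) J x" "{s..s0} \<subseteq> J"
      "\<And>t. t \<in> {s..s0} \<Longrightarrow> \<bar>reflect b t - x t\<bar> \<le> D / 4 * exp (- (\<delta> / 4) * (t - s))"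
      using s0 \<open>s \<le> s0\<close> by blast
    show "\<exists>J x. ivp_solution ?k s y0 J x \<and> {s..s0} \<subseteq> J \<and>
        (\<forall>t\<in>{s..s0}. \<bar>b (- t) - x t\<bar> \<le> D / 4 * exp (- (\<delta> / 4) * (t - s)))"
    proof (intro exI conjI ballI)
      show "ivp_solution ?k s y0 J (\<lambda>t. - x t)" using flip[OF J(1)] by simp
      show "{s..s0} \<subseteq> J" by (rule J)
      show "\<bar>b (- t) - - x t\<bar> \<le> D / 4 * exp (- (\<delta> / 4) * (t - s))" if "t \<in> {s..s0}" for t
        using J(3)[OF that] by (simp add: reflect_def abs_if split: if_splits)
    qed
  qed
  then show ?thesis by (simp add: locally_pullback_repulsive_def)
qed

end

section \<open>The two hyperbolic solutions of the limit equation\<close>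

lemma base_eq_riccati: "base_eq p = riccati (\<lambda>_. 0) p"
  by (simp add: base_eq_def[abs_def] riccati_def[abs_def])

lemma deriv_base_eq: "deriv (base_eq p t) y = - 2 * y"
  by (rule DERIV_imp_deriv) (auto intro!: derivative_eq_intros simp: base_eq_def[abs_def])

text \<open>Hyperbolicity becomes a statement about the increments of a primitive of \<open>2 * x\<close>.\<close>

lemma variation_integral:
  assumes x: "ode_solution (base_eq p) UNIV x" and X: "\<And>t. (X has_real_derivative 2 * x t) (at t)"
  shows "(LBINT l=ereal s..ereal t. deriv (base_eq p l) (x l)) = X s - X t"
proof -
  have "(LBINT l=ereal s..ereal t. - 2 * x l) = (- X t) - (- X s)"
  proof (rule interval_integral_FTC_finite)
    show "continuous_on {min s t..max s t} (\<lambda>l. - 2 * x l)"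
      by (intro continuous_intros continuous_on_subset[OF ode_solution_continuous[OF x]]) auto
    show "((\<lambda>l. - X l) has_vector_derivative - 2 * x l) (at l within {min s t..max s t})" for l
      using has_field_derivative_at_within[OF DERIV_minus[OF X[of l]]]
      by (simp add: has_real_derivative_iff_has_vector_derivative)
  qed
  then show ?thesis by (simp add: deriv_base_eq)
qed

lemma base_antiderivative:
  assumes "ode_solution (base_eq p) UNIV x"
  obtains X where "\<And>t. (X has_real_derivative 2 * x t) (at t)"
proof -
  have "continuous_on UNIV (\<lambda>t. 2 * x t)"
    by (intro continuous_intros ode_solution_continuous[OF assms])
  then show ?thesis using continuous_has_antiderivative that by blast
qed

lemma attractive_hyperbolicD:
  assumes "attractive_hyperbolic (base_eq p) x"
  obtains X k \<beta> where "ode_solution (riccati (\<lambda>_. 0) p) UNIV x"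
    "\<And>t. (X has_real_derivative 2 * x t) (at t)" "\<beta> > 0" "k \<ge> 1"
    "\<And>s t. s \<le> t \<Longrightarrow> exp (X s - X t) \<le> k * exp (- \<beta> * (t - s))"
proof -
  obtain k \<beta> where x: "ode_solution (base_eq p) UNIV x" and k: "k \<ge> 1" "\<beta> > 0" and
    bnd: "\<And>s t. s \<le> t \<Longrightarrow> exp (LBINT l=ereal s..ereal t. deriv (base_eq p l) (x l)) \<le> k * exp (- \<beta> * (t - s))"
    using assms unfolding attractive_hyperbolic_def by blast
  obtain X where X: "\<And>t. (X has_real_derivative 2 * x t) (at t)" using base_antiderivative[OF x] by blast
  show ?thesis
    by (rule that[OF x[unfolded base_eq_riccati] X k(2,1)]) (use bnd in \<open>simp add: variation_integral[OF x X]\<close>)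
qed

lemma repulsive_hyperbolicD:
  assumes "repulsive_hyperbolic (base_eq p) x"
  obtains X k \<beta> where "ode_solution (riccati (\<lambda>_. 0) p) UNIV x"
    "\<And>t. (X has_real_derivative 2 * x t) (at t)" "\<beta> > 0" "k \<ge> 1"
    "\<And>s t. t \<le> s \<Longrightarrow> exp (X s - X t) \<le> k * exp (- \<beta> * (s - t))"
proof -
  obtain k \<beta> where x: "ode_solution (base_eq p) UNIV x" and k: "k \<ge> 1" "\<beta> > 0" and
    bnd: "\<And>s t. t \<le> s \<Longrightarrow> exp (LBINT l=ereal s..ereal t. deriv (base_eq p l) (x l)) \<le> k * exp (\<beta> * (t - s))"
    using assms unfolding repulsive_hyperbolic_def by blast
  obtain X where X: "\<And>t. (X has_real_derivative 2 * x t) (at t)" using base_antiderivative[OF x] by blast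
  show ?thesis
    by (rule that[OF x[unfolded base_eq_riccati] X k(2,1)])
      (use bnd in \<open>simp add: variation_integral[OF x X] algebra_simps\<close>)
qed

text \<open>The difference satisfies \<open>(x - y)' = - (x + y) * (x - y)\<close>, so that \<open>(x - y)\<^sup>2 * exp (X + Y)\<close> is constant.
  As \<open>x - y\<close> is bounded, going to the end where both variations decay shows that \<open>x - y\<close> vanishes.\<close>

lemma solutions_with_decaying_variation_equal:
  assumes x: "ode_solution (riccati (\<lambda>_. 0) p) UNIV x" and y: "ode_solution (riccati (\<lambda>_. 0) p) UNIV y"
    and X: "\<And>t. (X has_real_derivative 2 * x t) (at t)" and Y: "\<And>t. (Y has_real_derivative 2 * y t) (at t)"
    and decay: "((\<lambda>s. exp (X s - X t)) \<longlongrightarrow> 0) F" "((\<lambda>s. exp (Y s - Y t)) \<longlongrightarrow> 0) F" "F \<noteq> bot"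
    and p: "\<And>t. \<bar>p t\<bar> \<le> P"
  shows "x t = y t"
proof -
  define f where "f t = (x t - y t)\<^sup>2 * exp (X t + Y t)" for t
  have "(f has_real_derivative 0) (at t)" for t
    unfolding f_def[abs_def]
    using ode_solutionD[OF x, of t] ode_solutionD[OF y, of t] X[of t] Y[of t]
    by (auto intro!: derivative_eq_intros simp: riccati_def power2_eq_square algebra_simps)
  then have const: "f s = f t" for s using DERIV_isconst_all by blast
  have eq: "(x t - y t)\<^sup>2 = (x s - y s)\<^sup>2 * (exp (X s - X t) * exp (Y s - Y t))" for s
    using const[of s] by (simp add: f_def exp_add exp_diff field_simps)
  define K where "K = 2 * (0 + 1 + 2 * P)"
  have bound: "(x s - y s)\<^sup>2 \<le> K\<^sup>2" for s
  proof -
    have "\<bar>x s - y s\<bar> \<le> K"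
      using riccati_global_bounded[OF x _ p, of 0 s] riccati_global_bounded[OF y _ p, of 0 s]
      by (simp add: K_def)
    then show ?thesis by (metis abs_ge_zero power2_abs power_mono)
  qed
  have "((\<lambda>s. K\<^sup>2 * (exp (X s - X t) * exp (Y s - Y t))) \<longlongrightarrow> K\<^sup>2 * (0 * 0)) F"
    by (intro tendsto_intros decay)
  moreover have "\<forall>\<^sub>F s in F. (x t - y t)\<^sup>2 \<le> K\<^sup>2 * (exp (X s - X t) * exp (Y s - Y t))"
  proof (intro always_eventually allI)
    show "(x t - y t)\<^sup>2 \<le> K\<^sup>2 * (exp (X s - X t) * exp (Y s - Y t))" for s
      unfolding eq[of s] by (rule mult_right_mono[OF bound]) simp
  qed
  ultimately have "(x t - y t)\<^sup>2 \<le> 0"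
    using tendsto_lowerbound decay(3) by fastforce
  then show ?thesis by simp
qed

lemma attractive_decay:
  assumes "\<beta> > 0" "\<And>s t. s \<le> t \<Longrightarrow> exp (X s - X t) \<le> k * exp (- \<beta> * (t - s :: real))"
  shows "((\<lambda>s. exp (X s - X t :: real)) \<longlongrightarrow> 0) at_bot"
  by (rule tendsto_sandwich[OF _ _ tendsto_const exponential_decay_at_bot[OF assms(1), of k t]])
    (use assms(2) in \<open>auto simp: eventually_at_bot_linorder\<close>)

lemma repulsive_decay:
  assumes "\<beta> > 0" "\<And>s t. t \<le> s \<Longrightarrow> exp (X s - X t) \<le> k * exp (- \<beta> * (s - t :: real))"
  shows "((\<lambda>s. exp (X s - X t :: real)) \<longlongrightarrow> 0) at_top"
  by (rule tendsto_sandwich[OF _ _ tendsto_const exponential_decay_at_top[OF assms(1), of k t]])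
    (use assms(2) in \<open>auto simp: eventually_at_top_linorder\<close>)

lemma attractive_hyperbolic_unique:
  assumes "attractive_hyperbolic (base_eq p) x" "attractive_hyperbolic (base_eq p) y"
    and p: "\<And>t. \<bar>p t\<bar> \<le> P"
  shows "x = y"
proof
  fix t
  obtain X k \<beta> where X: "ode_solution (riccati (\<lambda>_. 0) p) UNIV x"
    "\<And>t. (X has_real_derivative 2 * x t) (at t)" "\<beta> > 0" "k \<ge> 1"
    "\<And>s t. s \<le> t \<Longrightarrow> exp (X s - X t) \<le> k * exp (- \<beta> * (t - s))"
    by (rule attractive_hyperbolicD[OF assms(1)]) (rule that)
  obtain Y l \<mu> where Y: "ode_solution (riccati (\<lambda>_. 0) p) UNIV y"
    "\<And>t. (Y has_real_derivative 2 * y t) (at t)" "\<mu> > 0" "l \<ge> 1"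
    "\<And>s t. s \<le> t \<Longrightarrow> exp (Y s - Y t) \<le> l * exp (- \<mu> * (t - s))"
    by (rule attractive_hyperbolicD[OF assms(2)]) (rule that)
  show "x t = y t"
    by (rule solutions_with_decaying_variation_equal[OF X(1) Y(1) X(2) Y(2)
          attractive_decay[OF X(3,5)] attractive_decay[OF Y(3,5)] trivial_limit_at_bot_linorder p])
qed

lemma repulsive_hyperbolic_unique:
  assumes "repulsive_hyperbolic (base_eq p) x" "repulsive_hyperbolic (base_eq p) y"
    and p: "\<And>t. \<bar>p t\<bar> \<le> P"
  shows "x = y"
proof
  fix t
  obtain X k \<beta> where X: "ode_solution (riccati (\<lambda>_. 0) p) UNIV x"
    "\<And>t. (X has_real_derivative 2 * x t) (at t)" "\<beta> > 0" "k \<ge> 1"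
    "\<And>s t. t \<le> s \<Longrightarrow> exp (X s - X t) \<le> k * exp (- \<beta> * (s - t))"
    by (rule repulsive_hyperbolicD[OF assms(1)]) (rule that)
  obtain Y l \<mu> where Y: "ode_solution (riccati (\<lambda>_. 0) p) UNIV y"
    "\<And>t. (Y has_real_derivative 2 * y t) (at t)" "\<mu> > 0" "l \<ge> 1"
    "\<And>s t. t \<le> s \<Longrightarrow> exp (Y s - Y t) \<le> l * exp (- \<mu> * (s - t))"
    by (rule repulsive_hyperbolicD[OF assms(2)]) (rule that)
  show "x t = y t"
    by (rule solutions_with_decaying_variation_equal[OF X(1) Y(1) X(2) Y(2)
          repulsive_decay[OF X(3,5)] repulsive_decay[OF Y(3,5)] trivial_limit_at_top_linorder p])
qed

text \<open>There is at most one hyperbolic solution of each kind, so two hyperbolic solutions are of different kinds.\<close>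

lemma two_hyperbolic_solutions:
  assumes p: "\<And>t. \<bar>p t\<bar> \<le> P" and two: "card {x. hyperbolic_solution (base_eq p) x} = 2"
  shows "attractive_hyperbolic (base_eq p) (a_tilde p)" "repulsive_hyperbolic (base_eq p) (r_tilde p)"
    "a_tilde p \<noteq> r_tilde p"
proof -
  let ?A = "attractive_hyperbolic (base_eq p)" and ?R = "repulsive_hyperbolic (base_eq p)"
  obtain x y where xy: "{x. hyperbolic_solution (base_eq p) x} = {x, y}" "x \<noteq> y"
    using two by (auto simp: card_2_iff)
  have A1: "u = v" if "?A u" "?A v" for u v using attractive_hyperbolic_unique[OF that p] .
  have R1: "u = v" if "?R u" "?R v" for u v using repulsive_hyperbolic_unique[OF that p] .
  have "\<exists>u v. ?A u \<and> ?R v \<and> u \<noteq> v"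
  proof -
    have "?A x \<or> ?R x" "?A y \<or> ?R y" using xy(1) by (auto simp: hyperbolic_solution_def)
    then show ?thesis using A1[of x y] R1[of x y] xy(2) by metis
  qed
  then obtain u v where uv: "?A u" "?R v" "u \<noteq> v" by blast
  have "a_tilde p = u" unfolding a_tilde_def by (rule the_equality) (use uv A1 in blast)+
  moreover have "r_tilde p = v" unfolding r_tilde_def by (rule the_equality) (use uv R1 in blast)+
  ultimately show "?A (a_tilde p)" "?R (r_tilde p)" "a_tilde p \<noteq> r_tilde p" using uv by simp_all
qed

text \<open>Were \<open>r\<close> above \<open>a\<close>, then \<open>(r - a)' = - 2 * a * (r - a) - (r - a)\<^sup>2\<close> would show that \<open>r - a\<close> decays at
  least as fast as the variation along \<open>a\<close>, and boundedness in the past would give \<open>r = a\<close>.\<close>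

lemma attractive_above:
  assumes a: "ode_solution (riccati (\<lambda>_. 0) p) UNIV a" and r: "ode_solution (riccati (\<lambda>_. 0) p) UNIV r"
    and A: "\<And>t. (A has_real_derivative 2 * a t) (at t)"
    and decay: "\<And>t. ((\<lambda>s. exp (A s - A t)) \<longlongrightarrow> 0) at_bot"
    and p: "\<And>t. \<bar>p t\<bar> \<le> P" and "a \<noteq> r"
  shows "a t > r t"
proof (rule ccontr)
  have ne: "a t \<noteq> r t" for t using distinct_solutions[OF _ a r] \<open>a \<noteq> r\<close> by fastforce
  assume "\<not> a t > r t"
  then have lt: "r t > a t" using ne[of t] by simp
  define K where "K = 2 * (0 + 1 + 2 * P)"
  have K: "r s - a s \<le> K" for s
    using riccati_global_bounded[OF a _ p, of 0 s] riccati_global_bounded[OF r _ p, of 0 s]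
    by (simp add: K_def abs_le_iff)
  have bound: "r t - a t \<le> K * exp (A s - A t)" if "s \<le> t" for s
  proof -
    have "- ((r s - a s) * exp (A s)) \<le> - ((r t - a t) * exp (A t))"
    proof (rule nondecreasing_if_derivative_nonneg[OF that])
      show "((\<lambda>u. - ((r u - a u) * exp (A u))) has_real_derivative (r u - a u)\<^sup>2 * exp (A u)) (at u)" for u
        using ode_solutionD[OF a, of u] ode_solutionD[OF r, of u] A[of u]
        by (auto intro!: derivative_eq_intros simp: riccati_def power2_eq_square algebra_simps)
    qed simp
    moreover have "(r s - a s) * exp (A s) \<le> K * exp (A s)" by (rule mult_right_mono[OF K]) simp
    ultimately have "(r t - a t) * exp (A t) \<le> K * exp (A s)" by linarith
    then show ?thesis by (simp add: exp_diff field_simps)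
  qed
  have "((\<lambda>s. K * exp (A s - A t)) \<longlongrightarrow> K * 0) at_bot" by (intro tendsto_intros decay)
  then have "r t - a t \<le> K * 0"
    by (rule tendsto_lowerbound) (use bound in \<open>auto simp: eventually_at_bot_linorder\<close>)
  then show False using lt by simp
qed

text \<open>The reciprocal \<open>w\<close> of \<open>a - r\<close> solves the linear equation \<open>w' = 2 * a * w - 1\<close>. In backward time the
  homogeneous part decays exponentially by attractivity, and the inhomogeneous part contributes at most
  \<open>\<integral> k * exp (- \<beta> * u)\<close> over \<open>u \<ge> 0\<close>, which is \<open>k / \<beta>\<close>.\<close>

lemma reciprocal_gap_bounded_left:
  assumes a: "ode_solution (riccati (\<lambda>_. 0) p) UNIV a" and r: "ode_solution (riccati (\<lambda>_. 0) p) UNIV r"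
    and A: "\<And>t. (A has_real_derivative 2 * a t) (at t)"
    and hyp: "\<beta> > 0" "\<And>s t. s \<le> t \<Longrightarrow> exp (A s - A t) \<le> k * exp (- \<beta> * (t - s))"
    and gt: "\<And>t. a t > r t" and "k \<ge> 1" "s \<le> 0"
  shows "1 / (a s - r s) \<le> k / \<beta> + k / (a 0 - r 0)"
proof -
  define w where "w t = 1 / (a t - r t)" for t
  have w: "(w has_real_derivative 2 * a t * w t - 1) (at t)" for t
  proof -
    have nz: "a t - r t \<noteq> 0" using gt[of t] by simp
    have "((\<lambda>t. a t - r t) has_real_derivative - (a t + r t) * (a t - r t)) (at t)"
      using ode_solutionD[OF a, of t] ode_solutionD[OF r, of t]
      by (auto intro!: derivative_eq_intros simp: riccati_def power2_eq_square algebra_simps)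
    from DERIV_inverse'[OF this nz]
    have "(w has_real_derivative (a t + r t) / (a t - r t)) (at t)"
      unfolding w_def[abs_def] inverse_eq_divide[symmetric]
    proof (rule DERIV_cong)
      have "- (inverse d * (- e * d) * inverse d) = e / d" if "d \<noteq> 0" for d e :: real
        using that by (simp add: divide_inverse)
      from this[OF nz] show "- (inverse (a t - r t) * (- (a t + r t) * (a t - r t)) * inverse (a t - r t))
        = (a t + r t) / (a t - r t)" .
    qed
    also have "(a t + r t) / (a t - r t) = 2 * a t * w t - 1" using nz by (simp add: w_def field_simps)
    finally show ?thesis .
  qed
  have "w s * exp (- A s) - k / \<beta> * exp (- A s) * exp (- \<beta> * (s - s))
      \<le> w 0 * exp (- A 0) - k / \<beta> * exp (- A s) * exp (- \<beta> * (0 - s))"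
  proof (rule nondecreasing_if_derivative_nonneg[OF \<open>s \<le> 0\<close>])
    show "((\<lambda>u. w u * exp (- A u) - k / \<beta> * exp (- A s) * exp (- \<beta> * (u - s))) has_real_derivative
        - exp (- A u) + k * exp (- A s) * exp (- \<beta> * (u - s))) (at u)" for u
      using w[of u] A[of u] hyp(1) by (auto intro!: derivative_eq_intros simp: algebra_simps)
    show "0 \<le> - exp (- A u) + k * exp (- A s) * exp (- \<beta> * (u - s))" if "s \<le> u" for u
      using hyp(2)[OF that] by (simp add: exp_diff exp_minus field_simps)
  qed
  moreover have "k / \<beta> * exp (- A s) * exp (- \<beta> * (0 - s)) \<ge> 0" using \<open>k \<ge> 1\<close> hyp(1) by simp
  ultimately have "w s * exp (- A s) \<le> k / \<beta> * exp (- A s) + w 0 * exp (- A 0)" by simp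
  then have "w s * exp (- A s) * exp (A s) \<le> (k / \<beta> * exp (- A s) + w 0 * exp (- A 0)) * exp (A s)"
    by (rule mult_right_mono) simp
  then have *: "w s \<le> k / \<beta> + w 0 * exp (A s - A 0)"
    by (simp add: exp_diff exp_minus field_simps)
  have "exp (A s - A 0) \<le> k * exp (- \<beta> * (0 - s))" by (rule hyp(2)[OF \<open>s \<le> 0\<close>])
  also have "\<dots> \<le> k * 1" using \<open>k \<ge> 1\<close> \<open>s \<le> 0\<close> hyp(1) by (intro mult_left_mono) (auto simp: mult_nonneg_nonpos)
  finally have "w 0 * exp (A s - A 0) \<le> w 0 * k" using gt[of 0] by (intro mult_left_mono) (simp_all add: w_def)
  with * show ?thesis by (simp add: w_def)
qed

text \<open>Attractivity of \<open>a\<close> controls the gap in the past; repulsivity of \<open>r\<close> controls it in the future, which is the mirror image.\<close>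

lemma hyperbolic_gap:
  assumes att: "attractive_hyperbolic (base_eq p) a" and rep: "repulsive_hyperbolic (base_eq p) r"
    and "a \<noteq> r" and p: "\<And>t. \<bar>p t\<bar> \<le> P"
  shows "\<exists>\<delta>>0. \<forall>t. a t - r t \<ge> \<delta>"
proof -
  obtain A k \<beta> where A: "ode_solution (riccati (\<lambda>_. 0) p) UNIV a"
    "\<And>t. (A has_real_derivative 2 * a t) (at t)" "\<beta> > 0" "k \<ge> 1"
    "\<And>s t. s \<le> t \<Longrightarrow> exp (A s - A t) \<le> k * exp (- \<beta> * (t - s))"
    by (rule attractive_hyperbolicD[OF att]) (rule that)
  obtain R l \<mu> where R: "ode_solution (riccati (\<lambda>_. 0) p) UNIV r"
    "\<And>t. (R has_real_derivative 2 * r t) (at t)" "\<mu> > 0" "l \<ge> 1"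
    "\<And>s t. t \<le> s \<Longrightarrow> exp (R s - R t) \<le> l * exp (- \<mu> * (s - t))"
    by (rule repulsive_hyperbolicD[OF rep]) (rule that)
  have gt: "a t > r t" for t
    by (rule attractive_above[OF A(1) R(1) A(2) attractive_decay[OF A(3,5)] p \<open>a \<noteq> r\<close>])
  have refl0: "reflect (\<lambda>_. 0) = (\<lambda>_. 0)" by (simp add: reflect_def fun_eq_iff)
  have left: "1 / (a t - r t) \<le> k / \<beta> + k / (a 0 - r 0)" if "t \<le> 0" for t
    by (rule reciprocal_gap_bounded_left[OF A(1) R(1) A(2,3,5) gt A(4) that])
  have right: "1 / (a t - r t) \<le> l / \<mu> + l / (a 0 - r 0)" if "t \<ge> 0" for t
  proof -
    have "1 / (reflect r (- t) - reflect a (- t)) \<le> l / \<mu> + l / (reflect r 0 - reflect a 0)"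
    proof (rule reciprocal_gap_bounded_left[where A = "\<lambda>t. R (- t)" and p = "\<lambda>t. p (- t)"])
      show "ode_solution (riccati (\<lambda>_. 0) (\<lambda>t. p (- t))) UNIV (reflect r)"
        "ode_solution (riccati (\<lambda>_. 0) (\<lambda>t. p (- t))) UNIV (reflect a)"
        using ode_solution_reflect[OF A(1)] ode_solution_reflect[OF R(1)] by (simp_all add: refl0 surj_uminus)
      show "((\<lambda>t. R (- t)) has_real_derivative 2 * reflect r u) (at u)" for u
        using R(2)[of "- u"] DERIV_mirror[of R] by (simp add: reflect_def)
      show "exp (R (- u) - R (- v)) \<le> l * exp (- \<mu> * (v - u))" if "u \<le> v" for u v
        using R(5)[of "- v" "- u"] that by simp
      show "reflect a u < reflect r u" for u using gt[of "- u"] by (simp add: reflect_def)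
    qed (use R that in auto)
    then show ?thesis by (simp add: reflect_def)
  qed
  define M where "M = max (k / \<beta> + k / (a 0 - r 0)) (l / \<mu> + l / (a 0 - r 0))"
  have M: "1 / (a t - r t) \<le> M" for t using left[of t] right[of t] by (cases "t \<le> 0") (auto simp: M_def)
  have "M > 0" using less_le_trans[OF _ M[of 0]] gt[of 0] by simp
  moreover have "a t - r t \<ge> 1 / M" for t using M[of t] gt[of t] \<open>M > 0\<close> by (simp add: field_simps)
  ultimately show ?thesis by (intro exI[of _ "1 / M"]) auto
qed

section \<open>The transition driven by the arctangent\<close>

lemma E_eq_riccati: "E_eq p c = riccati (\<lambda>t. 2 / pi * arctan (c * t)) p"
  by (simp add: E_eq_def[abs_def] riccati_def[abs_def])

theorem theorem4p5:
  fixes p :: "real \<Rightarrow> real" and c :: real and b :: "real \<Rightarrow> real"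
  assumes p_bounded: "bounded (range p)"
    and p_uniformly_continuous: "uniformly_continuous_on UNIV p"
    and two_hyperbolic: "card {x. hyperbolic_solution (base_eq p) x} = 2"
    and c_pos: "c > 0"
    and b_bounded: "bounded_solution (E_eq p c) b"
    and b_unique: "\<And>x. bounded_solution (E_eq p c) x \<Longrightarrow> x = b"
  shows "(R_minus p c = UNIV \<and> R_plus p c = UNIV \<and> r_frak p c = b \<and> a_frak p c = b) \<and>
    (locally_pullback_attractive (E_eq p c) \<infinity> b \<and>
         locally_pullback_repulsive (E_eq p c) (-\<infinity>) b) \<and>
    (((\<lambda>t. \<bar>(a_tilde p t - 1) - b t\<bar>) \<longlongrightarrow> 0) at_bot \<and>
         ((\<lambda>t. \<bar>(r_tilde p t + 1) - b t\<bar>) \<longlongrightarrow> 0) at_top) \<and>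
    (\<forall>s y0.
         (y0 > b s \<longleftrightarrow> \<not> bounded (left_values (E_eq p c) s y0)) \<and>
         (y0 > b s \<longleftrightarrow>
            {s..} \<subseteq> max_interval (E_eq p c) s y0 \<and>
            ((\<lambda>t. \<bar>(a_tilde p t + 1) - max_sol (E_eq p c) t s y0\<bar>) \<longlongrightarrow> 0) at_top)) \<and>
    (\<forall>s y0.
         (y0 < b s \<longleftrightarrow> \<not> bounded (right_values (E_eq p c) s y0)) \<and>
         (y0 < b s \<longleftrightarrow>
            {..s} \<subseteq> max_interval (E_eq p c) s y0 \<and>
            ((\<lambda>t. \<bar>(r_tilde p t - 1) - max_sol (E_eq p c) t s y0\<bar>) \<longlongrightarrow> 0) at_bot))"
proof -
  define \<gamma> where "\<gamma> t = 2 / pi * arctan (c * t)" for t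
  define g where "g t = 2 / pi * (c / (1 + (c * t)\<^sup>2))" for t
  define a r where "a = a_tilde p" and "r = r_tilde p"
  have E: "E_eq p c = riccati \<gamma> p" by (simp add: E_eq_riccati \<gamma>_def[abs_def])
  obtain P where P: "\<And>t. \<bar>p t\<bar> \<le> P"
    using p_bounded by (auto simp: bounded_iff)
  note two = two_hyperbolic_solutions[OF P two_hyperbolic, folded a_def r_def]
  have a: "ode_solution (riccati (\<lambda>_. 0) p) UNIV a" and r: "ode_solution (riccati (\<lambda>_. 0) p) UNIV r"
    using two by (auto simp: attractive_hyperbolic_def repulsive_hyperbolic_def base_eq_riccati)
  obtain \<delta> where \<delta>: "\<delta> > 0" "\<And>t. a t - r t \<ge> \<delta>"
    using hyperbolic_gap[OF two P] by blast
  define D where "D = 2 * (0 + 1 + 2 * P)"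
  have \<gamma>_bound: "\<bar>\<gamma> t\<bar> \<le> 1" for t
  proof -
    have "2 * \<bar>arctan (c * t)\<bar> \<le> pi" using arctan_bounded[of "c * t"] by linarith
    then show ?thesis by (simp add: \<gamma>_def abs_mult)
  qed
  have lin: "filterlim (\<lambda>t. c * t) at_top at_top" "filterlim (\<lambda>t. c * t) at_bot at_bot"
    using c_pos by (auto intro: filterlim_tendsto_pos_mult_at_top[OF tendsto_const]
        filterlim_tendsto_pos_mult_at_bot[OF tendsto_const] filterlim_ident)
  have \<gamma>_lim: "(\<gamma> \<longlongrightarrow> 1) at_top" "(\<gamma> \<longlongrightarrow> -1) at_bot"
    using tendsto_mult[OF tendsto_const[of "2 / pi"] filterlim_compose[OF tendsto_arctan_at_top lin(1)]]
      tendsto_mult[OF tendsto_const[of "2 / pi"] filterlim_compose[OF tendsto_arctan_at_bot lin(2)]]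
    by (simp_all add: \<gamma>_def[abs_def])
  have g_lim: "(g \<longlongrightarrow> 0) F" if "filterlim (\<lambda>t. (c * t)\<^sup>2) at_top F" for F
  proof -
    have "filterlim (\<lambda>t. 1 + (c * t)\<^sup>2) at_top F"
      by (rule filterlim_tendsto_add_at_top[OF tendsto_const that])
    then have "((\<lambda>t. c / (1 + (c * t)\<^sup>2)) \<longlongrightarrow> 0) F"
      by (rule tendsto_divide_0[OF tendsto_const filterlim_mono[OF _ at_top_le_at_infinity order_refl]])
    from tendsto_mult[OF tendsto_const[of "2 / pi"] this] show ?thesis by (simp add: g_def[abs_def])
  qed
  interpret critical_transition \<gamma> g p a r b P \<delta> D
  proof
    show "(\<gamma> has_real_derivative g t) (at t)" for t
      unfolding \<gamma>_def[abs_def] g_def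
      by (auto intro!: derivative_eq_intros simp: add_nonneg_eq_0_iff field_simps)
    show "(g \<longlongrightarrow> 0) at_top"
      by (rule g_lim) (intro filterlim_pow_at_top lin, simp)
    show "(g \<longlongrightarrow> 0) at_bot"
      by (rule g_lim) (intro filterlim_pow_at_bot_even lin, simp_all)
    show "a t - r t \<le> D" for t
      using riccati_global_bounded[OF a _ P, of 0 t] riccati_global_bounded[OF r _ P, of 0 t]
      by (simp add: D_def abs_le_iff)
    show "ode_solution (riccati \<gamma> p) UNIV b"
      using b_bounded by (simp add: bounded_solution_def E)
    show "x = b" if x: "ode_solution (riccati \<gamma> p) UNIV x" for x
    proof (rule b_unique)
      have "\<bar>x t\<bar> \<le> 1 + 1 + 2 * P" for t by (rule riccati_global_bounded[OF x \<gamma>_bound P])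
      then show "bounded_solution (E_eq p c) x"
        using x by (auto simp: bounded_solution_def E bounded_iff)
    qed
  qed (use \<gamma>_bound \<gamma>_lim P a r \<delta> in auto)
  have minus: "R_minus p c = UNIV" "a_frak p c = b"
    using left_bdd_above_iff greatest_left_bdd_above
    by (auto simp: R_minus_def a_frak_def[abs_def] E)
  have plus: "R_plus p c = UNIV" "r_frak p c = b"
    using right_bdd_below_iff least_right_bdd_below
    by (auto simp: R_plus_def r_frak_def[abs_def] E)
  show ?thesis
    unfolding E a_def[symmetric] r_def[symmetric]
    using minus plus pullback_attractive pullback_repulsive b_at_bot b_at_top
      left_unbounded_iff forward_attraction_iff right_unbounded_iff backward_attraction_iff
    by simp
qed

end
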